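(* Let $X=\mathbb{P}^{m-1}\times\mathbb{P}^{m-1}\times\mathbb{P}^{m-1}$, with Cox ring $S$ and graded dual ring $T$, and $\mathbf 1=(1,1,1)$. If $F$ is a nonwild concise minimal border rank tensor in $T_{\mathbf 1}\cong\mathbb{C}^m\otimes\mathbb{C}^m\otimes\mathbb{C}^m$ (i.e. $\underline{\mathbf{rk}}(F)=m$), then $\underline{\mathrm{VSP}}(F,m)=\{K\}$, where $K=(I:B^\infty)$ is the saturation of $I=(\mathrm{Ann}(F)_{(1,1,0)})+(\mathrm{Ann}(F)_{(1,0,1)})+(\mathrm{Ann}(F)_{(0,1,1)})$.
   Context: $S=\mathbb{C}[\alpha_1,\dots,\alpha_m,\beta_1,\dots,\beta_m,\gamma_1,\dots,\gamma_m]$ is $\mathbb{Z}^3$-graded with $\deg\alpha_i=(1,0,0)$, $\deg\beta_j=(0,1,0)$, $\deg\gamma_k=(0,0,1)$; its irrelevant ideal $B$ is generated by all products $\alpha_i\beta_j\gamma_k$. $T$ is the polynomial ring in the dual variables with the same grading, on which $S$ acts by differentiation. $\mathrm{Ann}(F)=\{\psi\in S:\psi\circ F=0\}$; $(V)$ denotes the ideal generated by $V$. $F$ is concise if $\mathrm{Ann}(F)_{(1,0,0)}=\mathrm{Ann}(F)_{(0,1,0)}=\mathrm{Ann}(F)_{(0,0,1)}=0$. $X\subset\mathbb{P}(T_{\mathbf 1})$ via the Segre embedding; the border rank $\underline{\mathbf{rk}}(F)$ is the least $r$ with $[F]$ in the $r$-th secant variety of $X$; the smoothable rank $\mathrm{srk}(F)$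 is the least length of a finite smoothable subscheme $Z\subset X$ whose $B$-saturated ideal is contained in $\mathrm{Ann}(F)$. $F$ is wild if $\mathrm{srk}(F)>\underline{\mathbf{rk}}(F)$. $h_{r,X}(\mathbf u)=\min\{r,\dim_{\mathbb C}S_{\mathbf u}\}$; $\mathrm{Hilb}_S^{h_{r,X}}$ is the Haiman–Sturmfels multigraded Hilbert scheme of homogeneous ideals $J\subset S$ with $\dim_{\mathbb C}(S/J)_{\mathbf u}=h_{r,X}(\mathbf u)$ for all $\mathbf u$; $\mathrm{Slip}_{r,X}$ is its irreducible component that is the closure of the locus of $B$-saturated ideals of $r$ distinct points with Hilbert function $h_{r,X}$. $\underline{\mathrm{VSP}}(F,r)=\{J\in\mathrm{Slip}_{r,X}:J\subset\mathrm{Ann}(F)\}$. *)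

theory Defs
  imports Complex_Main "HOL-Library.Poly_Mapping" "HOL-Library.Cardinality"
begin

section \<open>Polynomials with complex coefficients\<close>

type_synonym 'v mon = "'v \<Rightarrow>\<^sub>0 nat"
type_synonym 'v pol = "('v \<Rightarrow>\<^sub>0 nat) \<Rightarrow>\<^sub>0 complex"

definition pol_eval :: "'v pol \<Rightarrow> ('v \<Rightarrow> complex) \<Rightarrow> complex" where
  "pol_eval p x = (\<Sum>t\<in>Poly_Mapping.keys p. Poly_Mapping.lookup p t * (\<Prod>v\<in>Poly_Mapping.keys t. x v ^ Poly_Mapping.lookup t v))"

definition cscale :: "complex \<Rightarrow> 'v pol \<Rightarrow> 'v pol" where
  "cscale c p = Poly_Mapping.single 0 c * p"

lemma vector_space_cscale: "vector_space (cscale :: complex \<Rightarrow> 'v pol \<Rightarrow> 'v pol)"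
  by unfold_locales
    (simp_all add: cscale_def algebra_simps single_add mult_single flip: mult.assoc)

lemma module_mult: "module ((*) :: 'a::comm_ring_1 \<Rightarrow> 'a \<Rightarrow> 'a)"
  by unfold_locales (simp_all add: algebra_simps)

abbreviation cdim :: "'v pol set \<Rightarrow> nat" where
  "cdim \<equiv> vector_space.dim cscale"

abbreviation cspan :: "'v pol set \<Rightarrow> 'v pol set" where
  "cspan \<equiv> module.span cscale"

text \<open>A commutative ring is a module over itself; its submodules are its ideals.\<close>

abbreviation is_ideal :: "'a::comm_ring_1 set \<Rightarrow> bool" where
  "is_ideal \<equiv> module.subspace (*)"

abbreviation ideal_gen :: "'a::comm_ring_1 set \<Rightarrow> 'a set" where
  "ideal_gen \<equiv> module.span (*)"

text \<open>Here \<^term>\<open>A\<close> is a set of points of an affine space with coordinates indexed by the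
  possibly infinite type \<^typ>\<open>'v\<close>; each polynomial involves only finitely many of them.\<close>

definition zariski_closure :: "('v \<Rightarrow> complex) set \<Rightarrow> ('v \<Rightarrow> complex) set" where
  "zariski_closure A = {x. \<forall>P. (\<forall>a\<in>A. pol_eval P a = 0) \<longrightarrow> pol_eval P x = 0}"


section \<open>The Cox ring and its graded dual\<close>

datatype 'n cvar = Alpha 'n | Beta 'n | Gamma 'n

text \<open>With \<^term>\<open>m = CARD('n)\<close>, the type \<^typ>\<open>'n cvar pol\<close> represents both \<open>S\<close> and \<open>T\<close>: the same
  index names a variable of \<open>S\<close> and the dual variable of \<open>T\<close>. Degrees are taken in
  \<^typ>\<open>nat \<times> nat \<times> nat\<close>, since all graded pieces in the remaining degrees of \<open>\<int>\<^sup>3\<close> vanish.\<close>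

type_synonym tridegree = "nat \<times> nat \<times> nat"

definition mon_deg :: "'n::finite cvar mon \<Rightarrow> tridegree" where
  "mon_deg t = (\<Sum>i\<in>UNIV. Poly_Mapping.lookup t (Alpha i), \<Sum>i\<in>UNIV. Poly_Mapping.lookup t (Beta i), \<Sum>i\<in>UNIV. Poly_Mapping.lookup t (Gamma i))"

definition graded_piece :: "tridegree \<Rightarrow> 'n::finite cvar pol set" where
  "graded_piece u = {p. \<forall>t\<in>Poly_Mapping.keys p. mon_deg t = u}"

definition hom_component :: "tridegree \<Rightarrow> 'n::finite cvar pol \<Rightarrow> 'n cvar pol" where
  "hom_component u p =
     (\<Sum>t\<in>{t \<in> Poly_Mapping.keys p. mon_deg t = u}. Poly_Mapping.single t (Poly_Mapping.lookup p t))"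

definition homogeneous_ideal :: "'n::finite cvar pol set \<Rightarrow> bool" where
  "homogeneous_ideal J \<longleftrightarrow> is_ideal J \<and> (\<forall>p\<in>J. \<forall>u. hom_component u p \<in> J)"

text \<open>\<open>dim (S/J)\<^sub>u\<close>, for a homogeneous ideal \<open>J\<close>; note that \<open>S\<^sub>u\<close> is finite-dimensional.\<close>

definition hilbert_fun :: "'n::finite cvar pol set \<Rightarrow> tridegree \<Rightarrow> nat" where
  "hilbert_fun J u = cdim (graded_piece u :: 'n cvar pol set) - cdim (J \<inter> graded_piece u)"

definition var :: "'v \<Rightarrow> 'v pol" where
  "var v = Poly_Mapping.single (Poly_Mapping.single v 1) 1"

definition irrelevant_ideal :: "'n cvar pol set" where
  "irrelevant_ideal = ideal_gen {var (Alpha i) * var (Beta j) * var (Gamma k) |i j k. True}"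

primrec ideal_power :: "'a::comm_ring_1 set \<Rightarrow> nat \<Rightarrow> 'a set" where
  "ideal_power I 0 = UNIV"
| "ideal_power I (Suc n) = ideal_gen {a * b |a b. a \<in> I \<and> b \<in> ideal_power I n}"

definition saturation :: "'a::comm_ring_1 set \<Rightarrow> 'a set \<Rightarrow> 'a set" where
  "saturation I L = {f. \<exists>n. \<forall>b\<in>ideal_power L n. f * b \<in> I}"

definition B_saturated :: "'n cvar pol set \<Rightarrow> bool" where
  "B_saturated J \<longleftrightarrow> saturation J irrelevant_ideal = J"

text \<open>The action \<open>\<psi> \<circ> F\<close> by differentiation: on monomials,
  \<open>\<alpha>\<^sup>a \<circ> x\<^sup>b = (\<Prod>v. b\<^sub>v! / (b\<^sub>v - a\<^sub>v)!) x\<^sup>b\<^sup>-\<^sup>a\<close> if \<open>a \<le> b\<close> componentwise, and \<open>0\<close> otherwise.\<close>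

definition diff_act :: "'v pol \<Rightarrow> 'v pol \<Rightarrow> 'v pol" where
  "diff_act \<psi> F = (\<Sum>a\<in>Poly_Mapping.keys \<psi>. \<Sum>b\<in>Poly_Mapping.keys F.
     if \<forall>v. Poly_Mapping.lookup a v \<le> Poly_Mapping.lookup b v
     then Poly_Mapping.single (b - a) (Poly_Mapping.lookup \<psi> a * Poly_Mapping.lookup F b *
            (\<Prod>v\<in>Poly_Mapping.keys a. fact (Poly_Mapping.lookup b v) / fact (Poly_Mapping.lookup b v - Poly_Mapping.lookup a v)))
     else 0)"

definition Ann :: "'v pol \<Rightarrow> 'v pol set" where
  "Ann F = {\<psi>. diff_act \<psi> F = 0}"

definition concise :: "'n::finite cvar pol \<Rightarrow> bool" where
  "concise F \<longleftrightarrow> Ann F \<inter> graded_piece (1,0,0) = {0} \<and>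
                 Ann F \<inter> graded_piece (0,1,0) = {0} \<and>
                 Ann F \<inter> graded_piece (0,0,1) = {0}"


section \<open>Points, the Segre embedding and border rank\<close>

text \<open>Closed points of \<open>X\<close> are orbits of triples of nonzero vectors under the torus.\<close>

definition cox_points :: "('n cvar \<Rightarrow> complex) set" where
  "cox_points = {p. (\<exists>i. p (Alpha i) \<noteq> 0) \<and> (\<exists>i. p (Beta i) \<noteq> 0) \<and> (\<exists>i. p (Gamma i) \<noteq> 0)}"

definition torus_rel :: "(('n cvar \<Rightarrow> complex) \<times> ('n cvar \<Rightarrow> complex)) set" where
  "torus_rel = {(p, q). p \<in> cox_points \<and> q \<in> cox_points \<and>
     (\<exists>a b c. a \<noteq> 0 \<and> b \<noteq> 0 \<and> c \<noteq> 0 \<and>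
       (\<forall>i. q (Alpha i) = a * p (Alpha i) \<and> q (Beta i) = b * p (Beta i) \<and> q (Gamma i) = c * p (Gamma i)))}"

definition X_points :: "('n cvar \<Rightarrow> complex) set set" where
  "X_points = cox_points // torus_rel"

definition vanishing_ideal :: "('n::finite cvar \<Rightarrow> complex) set set \<Rightarrow> 'n cvar pol set" where
  "vanishing_ideal P = {f. \<forall>u. \<forall>x\<in>P. \<forall>p\<in>x. pol_eval (hom_component u f) p = 0}"

text \<open>These ideals are \<open>B\<close>-saturated, as \<open>B\<close> has no zero on \<^const>\<open>cox_points\<close>.\<close>

definition ideals_of_distinct_points :: "nat \<Rightarrow> 'n::finite cvar pol set set" where
  "ideals_of_distinct_points r =
     {vanishing_ideal P |P. P \<subseteq> X_points \<and> finite P \<and> card P = r}"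

text \<open>The affine cone over the Segre embedding \<open>X \<subset> \<^bold>P(T\<^sub>1)\<close>.\<close>

definition segre :: "('n::finite cvar \<Rightarrow> complex) \<Rightarrow> 'n cvar pol" where
  "segre p = (\<Sum>i\<in>UNIV. cscale (p (Alpha i)) (var (Alpha i))) *
             (\<Sum>j\<in>UNIV. cscale (p (Beta j)) (var (Beta j))) *
             (\<Sum>k\<in>UNIV. cscale (p (Gamma k)) (var (Gamma k)))"

text \<open>The affine cone over the \<open>r\<close>-th secant variety, i.e. over the Zariski closure of the union of
  the spans of \<open>r\<close> points of \<open>X\<close>. Tensors are identified with their coefficient families.\<close>

definition secant_cone :: "nat \<Rightarrow> 'n::finite cvar pol set" where
  "secant_cone r = {F \<in> graded_piece (1,1,1).
     Poly_Mapping.lookup F \<in> zariski_closure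
       (Poly_Mapping.lookup ` (\<Union>p \<in> {p. \<forall>i<r. p i \<in> cox_points}. cspan ((\<lambda>i. segre (p i)) ` {..<r})))}"

definition border_rank :: "'n::finite cvar pol \<Rightarrow> nat" where
  "border_rank F = (LEAST r. F \<in> secant_cone r)"


section \<open>Zariski topology on Hilbert schemes\<close>

text \<open>Let \<open>h u = dim (S/J)\<^sub>u\<close> for all \<open>u\<close> in a set \<open>D\<close> of degrees. Then \<open>J\<close> defines a closed
  point of the product over \<open>u \<in> D\<close> of the Grassmannians of \<open>h u\<close>-dimensional quotients of
  \<open>S\<^sub>u\<close>. Each Grassmannian is the quotient, by the general linear group, of the open set of
  surjections \<open>S\<^sub>u \<rightarrow> \<complex>\<^sup>h\<^sup>(\<^sup>u\<^sup>)\<close> in an affine space of matrices. A frame of \<open>J\<close> is a choice of such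
  surjections with kernels \<open>J\<^sub>u\<close>; the entry \<open>\<phi> (t, i)\<close> is the \<open>i\<close>-th coordinate of the
  image of the monomial \<open>t\<close>. Entries with \<open>i \<ge> h u\<close> or in degrees outside \<open>D\<close> are unconstrained.\<close>

definition frame_map :: "('v mon \<times> nat \<Rightarrow> complex) \<Rightarrow> 'v pol \<Rightarrow> nat \<Rightarrow> complex" where
  "frame_map \<phi> f i = (\<Sum>t\<in>Poly_Mapping.keys f. Poly_Mapping.lookup f t * \<phi> (t, i))"

definition frames ::
  "tridegree set \<Rightarrow> (tridegree \<Rightarrow> nat) \<Rightarrow> 'n::finite cvar pol set \<Rightarrow> ('n cvar mon \<times> nat \<Rightarrow> complex) set" where
  "frames D h J = {\<phi>. \<forall>u\<in>D.
     (\<forall>c. \<exists>f\<in>graded_piece u. \<forall>i<h u. frame_map \<phi> f i = c i) \<and>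
     (\<forall>f\<in>graded_piece u. f \<in> J \<longleftrightarrow> (\<forall>i<h u. frame_map \<phi> f i = 0))}"

text \<open>The closure of \<open>L\<close> inside \<open>H\<close> for the topology induced from these Grassmannians. The frames of
  the members of \<open>L\<close> form a set stable under the general linear groups, hence so does its closure,
  and it does not matter which frame of \<open>J\<close> is tested.\<close>

definition closure_in ::
  "tridegree set \<Rightarrow> (tridegree \<Rightarrow> nat) \<Rightarrow> 'n::finite cvar pol set set \<Rightarrow> 'n cvar pol set set \<Rightarrow> 'n cvar pol set set" where
  "closure_in D h H L =
     {J \<in> H. frames D h J \<inter> zariski_closure (\<Union>J'\<in>L. frames D h J') \<noteq> {}}"


section \<open>Smoothable rank and wild tensors\<close>

text \<open>Finite subschemes of \<open>X\<close> of length \<open>r\<close> correspond to \<open>B\<close>-saturated homogeneous ideals with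
  constant Hilbert polynomial \<open>r\<close>.\<close>

definition finite_subschemes :: "nat \<Rightarrow> 'n::finite cvar pol set set" where
  "finite_subschemes r = {J. homogeneous_ideal J \<and> B_saturated J \<and>
     (\<exists>d. \<forall>a\<ge>d. \<forall>b\<ge>d. \<forall>c\<ge>d. hilbert_fun J (a, b, c) = r)}"

text \<open>Smoothable means being a limit, in the Hilbert scheme of \<open>r\<close> points of \<open>X\<close>, of sets of \<open>r\<close>
  distinct points. That Hilbert scheme carries the topology induced from the Grassmannians in
  degrees \<open>\<ge> (r,r,r)\<close>: there every length \<open>r\<close> subscheme has codimension exactly \<open>r\<close>,
  and by Gotzmann's theorem degree \<open>(r,r,r)\<close> already gives a closed embedding.\<close>

definition smoothable_subschemes :: "nat \<Rightarrow> 'n::finite cvar pol set set" where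
  "smoothable_subschemes r =
     closure_in {(a, b, c). r \<le> a \<and> r \<le> b \<and> r \<le> c} (\<lambda>_. r)
       (finite_subschemes r) (ideals_of_distinct_points r)"

definition smoothable_rank :: "'n::finite cvar pol \<Rightarrow> nat" where
  "smoothable_rank F = (LEAST r. \<exists>J\<in>smoothable_subschemes r. J \<subseteq> Ann F)"

definition wild :: "'n::finite cvar pol \<Rightarrow> bool" where
  "wild F \<longleftrightarrow> smoothable_rank F > border_rank F"


section \<open>Multigraded Hilbert schemes, Slip and the border variety of sums of powers\<close>

definition multigraded_hilb :: "(tridegree \<Rightarrow> nat) \<Rightarrow> 'n::finite cvar pol set set" where
  "multigraded_hilb h = {J. homogeneous_ideal J \<and> (\<forall>u. hilbert_fun J u = h u)}"

definition generic_hilbert_fun :: "'n::finite itself \<Rightarrow> nat \<Rightarrow> tridegree \<Rightarrow> nat" where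
  "generic_hilbert_fun _ r u = min r (cdim (graded_piece u :: 'n cvar pol set))"

text \<open>The multigraded Hilbert scheme embeds into a product of Grassmannians over finitely many
  degrees (Haiman--Sturmfels), so using the Grassmannians of all degrees gives its topology.\<close>

definition Slip :: "nat \<Rightarrow> 'n::finite cvar pol set set" where
  "Slip r = (let h = generic_hilbert_fun TYPE('n) r in
     closure_in UNIV h (multigraded_hilb h) (ideals_of_distinct_points r \<inter> multigraded_hilb h))"

definition border_VSP :: "'n::finite cvar pol \<Rightarrow> nat \<Rightarrow> 'n cvar pol set set" where
  "border_VSP F r = {J \<in> Slip r. J \<subseteq> Ann F}"

end

theory Submission
  imports Defs "HOL-Analysis.Determinants" "HOL-Analysis.Poly_Roots" "HOL-Library.Product_Plus"
begin

text \<open>Let \<open>m = CARD('n)\<close>. As \<open>F\<close> is not wild, some ideal \<open>J\<^sub>0 \<subseteq> Ann F\<close> of a smoothable scheme of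
  length \<open>r \<le> m\<close> exists. It is saturated, so it has a linear nonzerodivisor in each of the three
  groups of variables and its Hilbert function is nondecreasing; conciseness gives the value \<open>m\<close> in
  the degrees \<open>(1,0,0)\<close>, \<open>(0,1,0)\<close>, \<open>(0,0,1)\<close>, hence \<open>r = m\<close> and the Hilbert function is \<open>m\<close> in all
  nonzero degrees. In degree \<open>(1,1,0)\<close> conciseness also makes the codimension of \<open>Ann F\<close> at least \<open>m\<close>, so
  every ideal in \<open>Ann F\<close> with this Hilbert function agrees with \<open>Ann F\<close> there and contains \<open>I\<close>.
  Modulo the quadrics in \<open>I\<close>, a product of two variables of different groups is a multiple of one of
  the nonzerodivisors, and this yields \<open>(J\<^sub>0)\<^sub>u = I\<^sub>u\<close> as soon as two entries of \<open>u\<close> are nonzero. By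
  saturation, \<open>J\<^sub>0\<close> is the saturation of \<open>I\<close> and the only possible member of the border variety. It
  belongs to Slip because multiplication by a nonzerodivisor of degree \<open>(m,m,m)\<close> recovers the ideal in
  all degrees from its part in high degrees, algebraically in families.\<close>

section \<open>Relative bases and codimension\<close>

text \<open>The main obstacle is the passage from smoothable to Slip. Smoothability is tested only
  in degrees at least \<open>(m,m,m)\<close> and allows all sets of \<open>m\<close> points; Slip is
  tested in all degrees and allows only sets with the generic Hilbert function. The remedy is a
  fixed form of degree \<open>(m,m,m)\<close>, built from linear nonzerodivisors of the limit ideal.
  For an ideal of points with a frame, three determinants of size \<open>m\<close> test whether
  multiplication by this form is bijective on each space of linear forms. If so, the ideal contains
  no linear forms and no point is a zero of the form, which forces the generic Hilbert function.
  This condition is open and holds at the limit.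

  Linear nonzerodivisors are usually found by avoiding associated primes. Here primary decomposition
  is replaced by an integer, the limit inferior of the Hilbert function along the diagonal, which
  drops strictly when a saturated ideal is enlarged.

  The smoothable rank is a least number, so some smoothable scheme with ideal in
  \<open>Ann F\<close> has to be exhibited; the \<open>m^3\<close> coordinate points of
  \<open>X\<close> serve for every tensor.\<close>

context vector_space
begin

text \<open>The space of all polynomials is infinite-dimensional, so \<open>V\<close> is kept inside
  the span of a finite \<open>T\<close>; this makes dimensions meaningful and codimension a plain
  difference of cardinalities.\<close>

lemma relative_basis:
  assumes "subspace V" "subspace W" "W \<subseteq> V" "V \<subseteq> span T" "finite T"
  obtains B C where "finite B" "finite C" "B \<inter> C = {}" "independent (B \<union> C)" "span B = W"
    "span (B \<union> C) = V" "dim W = card B" "dim V = card B + card C"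
proof -
  obtain B where B: "B \<subseteq> W" "independent B" "W \<subseteq> span B" "card B = dim W"
    using basis_exists by blast
  obtain D where D: "B \<subseteq> D" "D \<subseteq> V" "independent D" "V \<subseteq> span D"
    using maximal_independent_subset_extend[of B V] B assms by blast
  have fD: "finite D" using independent_span_bound[of T D] D assms by auto
  then have fB: "finite B" using D finite_subset by blast
  show thesis
  proof (rule that[of B "D - B"])
    show "span B = W" using B assms(2) by (simp add: span_subspace)
    have *: "B \<union> (D - B) = D" using D by auto
    show "span (B \<union> (D - B)) = V" unfolding * using D assms(1) by (simp add: span_subspace)
    show "independent (B \<union> (D - B))" unfolding * using D by simp
    have "dim V = card D" using basis_card_eq_dim D by metis
    also have "\<dots> = card B + card (D - B)" using fD fB D(1)
      by (metis card_Diff_subset card_mono le_add_diff_inverse)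
    finally show "dim V = card B + card (D - B)" .
  qed (use fB fD B in auto)
qed

text \<open>A family independent modulo \<open>W\<close> stays independent when adjoined to a basis
  of \<open>W\<close>. The hypothesis concerns a family, so it also excludes repeated
  members.\<close>

lemma card_indep_mod_le:
  assumes "subspace V" "subspace W" "W \<subseteq> V" "V \<subseteq> span T" "finite T"
    and "finite K" "e ` K \<subseteq> V"
    and indep: "\<And>c. (\<Sum>k\<in>K. scale (c k) (e k)) \<in> W \<Longrightarrow> \<forall>k\<in>K. c k = 0"
  shows "card K + dim W \<le> dim V"
proof -
  obtain B C where B: "finite B" "finite C" "B \<inter> C = {}" "independent (B \<union> C)" "span B = W"
    "span (B \<union> C) = V" "dim W = card B" "dim V = card B + card C"
    using relative_basis assms(1-5) by metis
  have "independent (B \<union> e ` L) \<and> card (B \<union> e ` L) = card B + card L" if "L \<subseteq> K" "finite L" for L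
    using that(2,1)
  proof (induction L rule: finite_induct)
    case empty
    show ?case using B independent_mono[of "B \<union> C" B] by auto
  next
    case (insert k L)
    have "e k \<notin> span (B \<union> e ` L)"
    proof
      assume "e k \<in> span (B \<union> e ` L)"
      then obtain w s where w: "w \<in> W" and s: "s \<in> span (e ` L)" "e k = w + s"
        using B(5) unfolding span_Un by blast
      have "\<exists>a. s = (\<Sum>l\<in>L. scale (a l) (e l))"
        using s(1)
      proof (induction rule: span_induct_alt)
        case base
        show ?case by (rule exI[of _ "\<lambda>_. 0"]) simp
      next
        case (step c x y)
        from step(1) obtain l where l: "l \<in> L" "x = e l" by blast
        from step(2) obtain a where a: "y = (\<Sum>l\<in>L. scale (a l) (e l))" by blast
        have "scale c x = (\<Sum>i\<in>L. scale (if i = l then c else 0) (e i))"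
          using l insert(1) by (simp add: if_distrib[of "\<lambda>x. scale x _"] sum.delta cong: if_cong)
        then have "scale c x + y = (\<Sum>i\<in>L. scale ((if i = l then c else 0) + a i) (e i))"
          by (simp add: a sum.distrib scale_left_distrib)
        then show ?case by (rule exI[of _ "\<lambda>i. (if i = l then c else 0) + a i"])
      qed
      then obtain a where a: "s = (\<Sum>l\<in>L. scale (a l) (e l))" by blast
      \<comment> \<open>From \<open>e k = w + s\<close> with \<open>w\<close> in \<open>W\<close>,
        these coefficients give a combination that lies in \<open>W\<close> although its coefficient
        at \<open>k\<close> is \<open>1\<close>.\<close>
      define c where "c i = (if i = k then 1 else if i \<in> L then - a i else 0)" for i
      have "(\<Sum>i\<in>K. scale (c i) (e i)) = (\<Sum>i\<in>insert k L. scale (c i) (e i))"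
        using insert assms(6) by (intro sum.mono_neutral_right) (auto simp: c_def)
      also have "\<dots> = e k + (\<Sum>i\<in>L. scale (c i) (e i))"
        using insert by (simp add: c_def)
      also have "(\<Sum>i\<in>L. scale (c i) (e i)) = (\<Sum>i\<in>L. - scale (a i) (e i))"
        by (rule sum.cong) (use insert in \<open>auto simp: c_def\<close>)
      also have "e k + \<dots> = w" using s a by (simp add: sum_negf)
      finally have "c k = 0" using indep[of c] w insert.prems by auto
      then show False by (simp add: c_def)
    qed
    have IH: "independent (B \<union> e ` L)" "card (B \<union> e ` L) = card B + card L"
      using insert by auto
    have 1: "independent (insert (e k) (B \<union> e ` L))"
      by (rule independent_insertI) fact+
    have "e k \<notin> B \<union> e ` L" using \<open>e k \<notin> span (B \<union> e ` L)\<close> span_base[of "e k" "B \<union> e ` L"] by metis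
    then have 2: "card (insert (e k) (B \<union> e ` L)) = Suc (card B + card L)"
      using card_insert_disjoint[of "B \<union> e ` L" "e k"] insert.hyps B(1) IH(2) by simp
    have "B \<union> e ` insert k L = insert (e k) (B \<union> e ` L)" by auto
    with 1 2 show ?case using insert.hyps by simp
  qed
  from this[of K] have ind: "independent (B \<union> e ` K)" and c: "card (B \<union> e ` K) = card B + card K"
    using assms(6) by auto
  have "B \<union> e ` K \<subseteq> span (B \<union> C)"
    using B assms(7) span_superset[of B] assms(3) by auto
  then have "card (B \<union> e ` K) \<le> card (B \<union> C)"
    using independent_span_bound[OF _ ind, of "B \<union> C"] B by auto
  then show ?thesis using c B by (simp add: card_Un_disjoint)
qed

lemma dim_le_spanning_mod:
  assumes "subspace V" "subspace W" "W \<subseteq> V" "V \<subseteq> span T" "finite T" "finite K"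
    and spans: "\<And>f. f \<in> V \<Longrightarrow> \<exists>c. f - (\<Sum>k\<in>K. scale (c k) (e k)) \<in> W"
  shows "dim V \<le> card K + dim W"
proof -
  obtain B C where B: "finite B" "finite C" "B \<inter> C = {}" "independent (B \<union> C)" "span B = W"
    "span (B \<union> C) = V" "dim W = card B" "dim V = card B + card C"
    using relative_basis assms(1-5) by metis
  have "V \<subseteq> span (B \<union> e ` K)"
  proof
    fix f assume "f \<in> V"
    then obtain c where c: "f - (\<Sum>k\<in>K. scale (c k) (e k)) \<in> W" using spans by blast
    have "(\<Sum>k\<in>K. scale (c k) (e k)) \<in> span (B \<union> e ` K)"
      by (intro span_sum span_scale span_base) auto
    moreover have "f - (\<Sum>k\<in>K. scale (c k) (e k)) \<in> span (B \<union> e ` K)"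
      using c B(5) span_mono[of B "B \<union> e ` K"] by auto
    ultimately have "(f - (\<Sum>k\<in>K. scale (c k) (e k))) + (\<Sum>k\<in>K. scale (c k) (e k)) \<in> span (B \<union> e ` K)"
      by (rule span_add[rotated])
    then show "f \<in> span (B \<union> e ` K)" by simp
  qed
  then have "dim V \<le> card (B \<union> e ` K)" using B(1) assms(6) by (intro dim_le_card) auto
  also have "\<dots> \<le> card B + card (e ` K)" by (rule card_Un_le)
  also have "\<dots> \<le> card B + card K" using assms(6) card_image_le by auto
  finally show ?thesis using B by simp
qed

lemma exists_basis_mod:
  assumes "subspace V" "subspace W" "W \<subseteq> V" "V \<subseteq> span T" "finite T"
  shows "\<exists>e :: nat \<Rightarrow> 'b. (\<forall>k < dim V - dim W. e k \<in> V) \<and>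
    (\<forall>c. (\<Sum>k<dim V - dim W. scale (c k) (e k)) \<in> W \<longrightarrow> (\<forall>k < dim V - dim W. c k = 0))"
proof -
  obtain B C where B: "finite B" "finite C" "B \<inter> C = {}" "independent (B \<union> C)" "span B = W"
    "span (B \<union> C) = V" "dim W = card B" "dim V = card B + card C"
    using relative_basis assms(1-5) by metis
  have d: "dim V - dim W = card C" using B by simp
  obtain e where e: "bij_betw e {..<card C} C"
    using ex_bij_betw_nat_finite[OF B(2)] by (auto simp: lessThan_atLeast0)
  have "\<forall>k<card C. c k = 0" if "(\<Sum>k<card C. scale (c k) (e k)) \<in> W" for c
  proof -
    define c' where "c' = (\<lambda>v. c (the_inv_into {..<card C} e v))"
    have inj: "inj_on e {..<card C}" using e by (simp add: bij_betw_def)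
    have c': "c' (e k) = c k" if "k < card C" for k
      using that inj by (simp add: c'_def the_inv_into_f_f)
    have "(\<Sum>k<card C. scale (c k) (e k)) = (\<Sum>k<card C. scale (c' (e k)) (e k))"
      by (rule sum.cong) (simp_all add: c')
    also have "\<dots> = (\<Sum>v\<in>C. scale (c' v) v)"
      by (rule sum.reindex_bij_betw[OF e])
    finally have "(\<Sum>v\<in>C. scale (c' v) v) \<in> span B" using that B by simp
    then obtain b where b: "(\<Sum>v\<in>C. scale (c' v) v) = (\<Sum>v\<in>B. scale (b v) v)"
      using span_finite[OF B(1)] by auto
    \<comment> \<open>The relation modulo \<open>W\<close> becomes a genuine linear relation on the
      disjoint union of \<open>B\<close> and \<open>C\<close>.\<close>
    define d where "d v = (if v \<in> C then c' v else - b v)" for v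
    have "(\<Sum>v\<in>B \<union> C. scale (d v) v) = (\<Sum>v\<in>B. scale (d v) v) + (\<Sum>v\<in>C. scale (d v) v)"
      using B by (intro sum.union_disjoint)
    also have "(\<Sum>v\<in>B. scale (d v) v) = (\<Sum>v\<in>B. - scale (b v) v)"
      using B(3) by (intro sum.cong) (auto simp: d_def)
    also have "(\<Sum>v\<in>C. scale (d v) v) = (\<Sum>v\<in>C. scale (c' v) v)"
      by (intro sum.cong) (auto simp: d_def)
    finally have "(\<Sum>v\<in>B \<union> C. scale (d v) v) = 0" by (simp add: b sum_negf)
    then have "\<forall>v\<in>B \<union> C. d v = 0" using independentD[OF B(4), of "B \<union> C"] B by auto
    then have "d v = 0" if "v \<in> C" for v using that by blast
    then have "\<forall>v\<in>C. c' v = 0" by (simp add: d_def)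
    moreover have "e k \<in> C" if "k < card C" for k using e that by (auto simp: bij_betw_def)
    ultimately show ?thesis using c' by auto
  qed
  moreover have "\<forall>k<card C. e k \<in> V"
    using e span_superset[of "B \<union> C"] B(6) by (auto simp: bij_betw_def)
  ultimately show ?thesis unfolding d by blast
qed

end

section \<open>Graded pieces and Hilbert functions\<close>

abbreviation lookup where "lookup \<equiv> Poly_Mapping.lookup"
abbreviation keys where "keys \<equiv> Poly_Mapping.keys"
abbreviation single where "single \<equiv> Poly_Mapping.single"

interpretation poly: vector_space "cscale :: complex \<Rightarrow> 'v pol \<Rightarrow> 'v pol"
  by (rule vector_space_cscale)

interpretation ideal: module "(*) :: 'a::comm_ring_1 \<Rightarrow> 'a \<Rightarrow> 'a"
  by (rule module_mult)

declare ideal.scale_scale [simp del]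

lemma lookup_cscale: "lookup (cscale c p) t = c * lookup p t"
proof -
  have "cscale c p = Poly_Mapping.map ((*) c) p"
    by (simp add: cscale_def mult_map_scale_conv_mult)
  then show ?thesis by (simp add: Poly_Mapping.map.rep_eq when_def)
qed

lemma cscale_mult_left: "cscale c p * q = cscale c (p * q)"
  by (simp add: cscale_def mult.assoc)

lemma pol_expand: "p = (\<Sum>t\<in>keys p. single t (lookup p t))"
  by (rule poly_mapping_eqI)
    (auto simp: lookup_sum lookup_single when_def sum.delta in_keys_iff)

lemma single_eq_cscale: "single t c = cscale c (single t 1)"
  by (simp add: cscale_def mult_single)

lemma ideal_cscale: "is_ideal J \<Longrightarrow> p \<in> J \<Longrightarrow> cscale c p \<in> J"
  unfolding cscale_def by (rule ideal.subspace_scale)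

lemma is_idealI:
  assumes "0 \<in> J" "\<And>a b. a \<in> J \<Longrightarrow> b \<in> J \<Longrightarrow> a + b \<in> J" "\<And>a b. b \<in> J \<Longrightarrow> a * b \<in> J"
  shows "is_ideal J"
  using assms by (auto intro!: ideal.subspaceI)

lemma subspace_of_ideal: "is_ideal J \<Longrightarrow> poly.subspace J"
  by (auto intro!: poly.subspaceI ideal_cscale ideal.subspace_0 ideal.subspace_add)

lemma ideal_mult_left: "is_ideal J \<Longrightarrow> p \<in> J \<Longrightarrow> q * p \<in> J"
  by (rule ideal.subspace_scale)

lemma ideal_mult_right: "is_ideal J \<Longrightarrow> p \<in> J \<Longrightarrow> p * q \<in> J"
  using ideal_mult_left[of J p q] by (simp add: mult.commute)

lemma graded_piece_iff: "p \<in> graded_piece u \<longleftrightarrow> (\<forall>t. lookup p t \<noteq> 0 \<longrightarrow> mon_deg t = u)"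
  by (auto simp: graded_piece_def in_keys_iff)

lemma subspace_graded_piece: "poly.subspace (graded_piece u)"
proof (rule poly.subspaceI)
  fix p q :: "'a cvar pol" assume "p \<in> graded_piece u" "q \<in> graded_piece u"
  then show "p + q \<in> graded_piece u"
    unfolding graded_piece_iff lookup_add by (metis add.left_neutral)
qed (auto simp: graded_piece_iff lookup_cscale)

lemma mon_deg_add: "mon_deg (s + t) = mon_deg s + mon_deg t"
  by (simp add: mon_deg_def lookup_add sum.distrib)

lemma mon_deg_0 [simp]: "mon_deg 0 = 0"
  by (simp add: mon_deg_def zero_prod_def)

lemma mult_in_graded_piece:
  assumes "f \<in> graded_piece u" "g \<in> graded_piece v"
  shows "f * g \<in> graded_piece (u + v)"
  using assms keys_mult[of f g] by (fastforce simp: graded_piece_def mon_deg_add)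

lemma single_in_graded_piece: "mon_deg t = u \<Longrightarrow> single t c \<in> graded_piece u"
  by (auto simp: graded_piece_iff lookup_single when_def split: if_splits)

lemma lookup_hom_component: "lookup (hom_component u p) t = (if mon_deg t = u then lookup p t else 0)"
  by (simp add: hom_component_def lookup_sum lookup_single when_def sum.delta in_keys_iff)

lemma hom_component_add: "hom_component u (p + q) = hom_component u p + hom_component u q"
  by (rule poly_mapping_eqI) (simp add: lookup_hom_component lookup_add)

lemma hom_component_0 [simp]: "hom_component u 0 = 0"
  by (rule poly_mapping_eqI) (simp add: lookup_hom_component)

lemma hom_component_sum: "hom_component u (\<Sum>i\<in>A. f i) = (\<Sum>i\<in>A. hom_component u (f i))"
  by (induction A rule: infinite_finite_induct) (simp_all add: hom_component_add)

lemma hom_component_in: "hom_component u p \<in> graded_piece u"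
  by (simp add: graded_piece_iff lookup_hom_component)

lemma hom_component_graded: "p \<in> graded_piece v \<Longrightarrow> hom_component u p = (if u = v then p else 0)"
  by (rule poly_mapping_eqI) (auto simp: graded_piece_iff lookup_hom_component)

lemma sum_hom_components: "p = (\<Sum>u\<in>mon_deg ` keys p. hom_component u p)"
  by (rule poly_mapping_eqI) (auto simp: lookup_sum lookup_hom_component sum.delta' in_keys_iff)

lemma hom_component_mult:
  assumes "g \<in> graded_piece v"
  shows "hom_component (u + v) (f * g) = hom_component u f * g"
proof -
  have "hom_component (u + v) (f * g)
      = hom_component (u + v) ((\<Sum>w\<in>mon_deg ` keys f. hom_component w f) * g)"
    using sum_hom_components[of f] by simp
  also have "\<dots> = (\<Sum>w\<in>mon_deg ` keys f. hom_component (u + v) (hom_component w f * g))"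
    by (simp add: sum_distrib_right hom_component_sum)
  also have "\<dots> = (\<Sum>w\<in>mon_deg ` keys f. if u = w then hom_component w f * g else 0)"
  proof (rule sum.cong)
    fix w
    show "hom_component (u + v) (hom_component w f * g) = (if u = w then hom_component w f * g else 0)"
      using hom_component_graded[OF mult_in_graded_piece[OF hom_component_in assms], of "u + v" w f]
      by simp
  qed simp
  also have "\<dots> = hom_component u f * g"
  proof (cases "u \<in> mon_deg ` keys f")
    case False
    then have "hom_component u f = 0"
      by (intro poly_mapping_eqI) (auto simp: lookup_hom_component in_keys_iff)
    with False show ?thesis by (auto simp: sum.delta)
  qed (simp add: sum.delta)
  finally show ?thesis .
qed

lemma homogeneous_ideal_iff:
  "homogeneous_ideal J \<Longrightarrow> p \<in> J \<longleftrightarrow> (\<forall>u. hom_component u p \<in> J)"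
  using sum_hom_components[of p] ideal.subspace_sum[of J "mon_deg ` keys p" "\<lambda>u. hom_component u p"]
  by (auto simp: homogeneous_ideal_def)

lemma homogeneous_is_ideal: "homogeneous_ideal J \<Longrightarrow> is_ideal J"
  by (simp add: homogeneous_ideal_def)

lemma homogeneous_ideal_eqI:
  assumes "homogeneous_ideal J" "homogeneous_ideal J'"
    "\<And>u. J \<inter> graded_piece u = J' \<inter> graded_piece u"
  shows "J = J'"
proof -
  have "p \<in> J \<longleftrightarrow> p \<in> J'" for p
    using homogeneous_ideal_iff[OF assms(1), of p] homogeneous_ideal_iff[OF assms(2), of p]
      assms(3) hom_component_in[of _ p] by blast
  then show ?thesis by blast
qed

section \<open>Variables, axes and monomials of a given degree\<close>

instance cvar :: (finite) finite
proof
  have "(UNIV :: 'a cvar set) = range Alpha \<union> range Beta \<union> range Gamma"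
  proof (rule set_eqI)
    fix v :: "'a cvar"
    show "v \<in> UNIV \<longleftrightarrow> v \<in> range Alpha \<union> range Beta \<union> range Gamma" by (cases v) auto
  qed
  moreover have "finite (range Alpha \<union> range Beta \<union> range Gamma :: 'a cvar set)"
    by (intro finite_UnI finite_imageI finite)
  ultimately show "finite (UNIV :: 'a cvar set)" by metis
qed

text \<open>The three groups of variables play symmetric roles; an index type lets one argument with
  a variable axis replace three copies.\<close>

datatype axis = X1 | X2 | X3

primrec avar :: "axis \<Rightarrow> 'n \<Rightarrow> 'n cvar" where
  "avar X1 = Alpha" | "avar X2 = Beta" | "avar X3 = Gamma"

primrec udeg :: "axis \<Rightarrow> tridegree" where
  "udeg X1 = (1, 0, 0)" | "udeg X2 = (0, 1, 0)" | "udeg X3 = (0, 0, 1)"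

primrec coord :: "axis \<Rightarrow> tridegree \<Rightarrow> nat" where
  "coord X1 u = fst u" | "coord X2 u = fst (snd u)" | "coord X3 u = snd (snd u)"

lemma avar_eq_iff [simp]: "avar a i = avar b j \<longleftrightarrow> a = b \<and> i = j"
  by (cases a; cases b) auto

lemma cvar_eq_avar: obtains a i where "v = avar a i"
  by (cases v) (metis avar.simps)+

lemma coord_mon_deg: "coord a (mon_deg t) = (\<Sum>i\<in>UNIV. lookup t (avar a i))"
  by (cases a) (simp_all add: mon_deg_def)

lemma tridegree_eqI: "(\<And>a. coord a u = coord a v) \<Longrightarrow> u = v"
  by (metis coord.simps prod.collapse)

lemma coord_add [simp]: "coord a (u + v) = coord a u + coord a v"
  by (cases a) simp_all

lemma coord_0 [simp]: "coord a 0 = 0"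
  by (cases a) simp_all

lemma coord_udeg: "coord a (udeg b) = (if a = b then 1 else 0)"
  by (cases a; cases b) simp_all

lemma mon_deg_avar: "mon_deg (single (avar a i) 1) = udeg a"
  by (cases a) (simp_all add: mon_deg_def lookup_single when_def sum.delta')

lemma lookup_le_coord_mon_deg: "lookup t (avar a i) \<le> coord a (mon_deg t)"
  unfolding coord_mon_deg by (rule member_le_sum) auto

lemma finite_mon_deg: "finite {t :: 'n::finite cvar mon. mon_deg t = u}"
proof (rule finite_imageD)
  define b where "b = coord X1 u + coord X2 u + coord X3 u"
  have "lookup t v \<le> b" if "mon_deg t = u" for t :: "'n cvar mon" and v
  proof -
    obtain a i where v: "v = avar a i" by (rule cvar_eq_avar)
    have "coord a u \<le> b" unfolding b_def by (cases a) simp_all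
    then show ?thesis using lookup_le_coord_mon_deg[of t a i] that v by simp
  qed
  then have "lookup ` {t :: 'n cvar mon. mon_deg t = u} \<subseteq> (PiE UNIV (\<lambda>_. {..b}))"
    by auto
  then show "finite (lookup ` {t :: 'n cvar mon. mon_deg t = u})"
    by (rule finite_subset) (intro finite_PiE; simp)
  show "inj_on lookup {t :: 'n cvar mon. mon_deg t = u}"
    by (rule inj_onI) (simp add: Poly_Mapping.lookup_inject)
qed

section \<open>Bases of graded pieces modulo a subspace\<close>

lemma graded_piece_subset_span:
  "graded_piece u \<subseteq> poly.span ((\<lambda>t. single t 1) ` {t. mon_deg t = u})"
proof
  fix p :: "'a cvar pol" assume p: "p \<in> graded_piece u"
  have "(\<Sum>t\<in>keys p. cscale (lookup p t) (single t 1)) \<in> poly.span ((\<lambda>t. single t 1) ` {t. mon_deg t = u})"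
    using p by (intro poly.span_sum poly.span_scale poly.span_base) (auto simp: graded_piece_def)
  then show "p \<in> poly.span ((\<lambda>t. single t 1) ` {t. mon_deg t = u})"
    using pol_expand[of p] by (metis (no_types, lifting) single_eq_cscale sum.cong)
qed

text \<open>Independence of classes modulo \<open>J\<close>, for families rather than sets, so that
  passing from \<open>e k\<close> to \<open>e k * g\<close> needs no injectivity argument.\<close>

definition indep_mod :: "'v pol set \<Rightarrow> 'k set \<Rightarrow> ('k \<Rightarrow> 'v pol) \<Rightarrow> bool" where
  "indep_mod J K e \<longleftrightarrow> (\<forall>c. (\<Sum>k\<in>K. cscale (c k) (e k)) \<in> J \<longrightarrow> (\<forall>k\<in>K. c k = 0))"

lemma sum_cscale_graded: "e ` K \<subseteq> graded_piece u \<Longrightarrow> (\<Sum>k\<in>K. cscale (c k) (e k)) \<in> graded_piece u"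
  by (intro poly.subspace_sum poly.subspace_scale subspace_graded_piece) auto

context
  fixes J :: "'n::finite cvar pol set"
  assumes J: "poly.subspace J"
begin

lemma subspace_Int_graded_piece:
  "poly.subspace (J \<inter> graded_piece u)" "J \<inter> graded_piece u \<subseteq> graded_piece u"
  "finite ((\<lambda>t. single t (1::complex)) ` {t :: 'n cvar mon. mon_deg t = u})"
  using J by (auto intro: poly.subspace_inter subspace_graded_piece finite_imageI finite_mon_deg)

text \<open>Dimension counts in the quotient are done with families: independent ones bound the
  Hilbert function from below, spanning ones from above.\<close>

lemma card_le_hilbert_fun:
  assumes "finite K" "e ` K \<subseteq> graded_piece u" "indep_mod J K e"
  shows "card K \<le> hilbert_fun J u"
proof -
  have "card K + cdim (J \<inter> graded_piece u) \<le> cdim (graded_piece u :: 'n cvar pol set)"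
    using assms(3)
    by (intro poly.card_indep_mod_le[of "graded_piece u" "J \<inter> graded_piece u"
          "(\<lambda>t. single t 1) ` {t. mon_deg t = u}" K e] subspace_Int_graded_piece subspace_graded_piece
          graded_piece_subset_span assms(1,2)) (auto simp: indep_mod_def)
  then show ?thesis by (simp add: hilbert_fun_def)
qed

lemma hilbert_fun_le_card:
  assumes "finite K" and "\<And>f. f \<in> graded_piece u \<Longrightarrow> \<exists>c. f - (\<Sum>k\<in>K. cscale (c k) (e k)) \<in> J"
    and e: "e ` K \<subseteq> graded_piece u"
  shows "hilbert_fun J u \<le> card K"
proof -
  have "cdim (graded_piece u :: 'n cvar pol set) \<le> card K + cdim (J \<inter> graded_piece u)"
  proof (rule poly.dim_le_spanning_mod[of "graded_piece u" "J \<inter> graded_piece u"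
          "(\<lambda>t. single t 1) ` {t. mon_deg t = u}" K e,
          OF subspace_graded_piece subspace_Int_graded_piece(1,2) graded_piece_subset_span subspace_Int_graded_piece(3) assms(1)])
    fix f :: "'n cvar pol" assume f: "f \<in> graded_piece u"
    then obtain c where "f - (\<Sum>k\<in>K. cscale (c k) (e k)) \<in> J" using assms(2) by blast
    then show "\<exists>c. f - (\<Sum>k\<in>K. cscale (c k) (e k)) \<in> J \<inter> graded_piece u"
      using poly.subspace_diff[OF subspace_graded_piece f sum_cscale_graded[OF e]] by blast
  qed
  then show ?thesis by (simp add: hilbert_fun_def)
qed

lemma exists_hilbert_basis:
  obtains e :: "nat \<Rightarrow> 'n cvar pol"
  where "e ` {..<hilbert_fun J u} \<subseteq> graded_piece u" "indep_mod J {..<hilbert_fun J u} e"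
proof -
  obtain e :: "nat \<Rightarrow> 'n cvar pol" where e: "\<forall>k<hilbert_fun J u. e k \<in> graded_piece u"
    "\<forall>c. (\<Sum>k<hilbert_fun J u. cscale (c k) (e k)) \<in> J \<inter> graded_piece u \<longrightarrow> (\<forall>k<hilbert_fun J u. c k = 0)"
    using poly.exists_basis_mod[OF subspace_graded_piece subspace_Int_graded_piece(1,2)
          graded_piece_subset_span subspace_Int_graded_piece(3), of u] unfolding hilbert_fun_def by blast
  show thesis
    by (rule that[of e]) (use e sum_cscale_graded[of e "{..<hilbert_fun J u}" u] in
        \<open>auto simp: indep_mod_def image_subset_iff\<close>)
qed

lemma indep_mod_insert:
  assumes "finite K" "indep_mod J K e" "k \<notin> K"
    and "\<nexists>c. e k - (\<Sum>k\<in>K. cscale (c k) (e k)) \<in> J"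
  shows "indep_mod J (insert k K) e"
  unfolding indep_mod_def
proof (intro allI impI)
  fix c assume *: "(\<Sum>k\<in>insert k K. cscale (c k) (e k)) \<in> J"
  have "c k = 0"
  proof (rule ccontr)
    assume c: "c k \<noteq> 0"
    have "cscale (1 / c k) (\<Sum>k\<in>insert k K. cscale (c k) (e k)) \<in> J"
      using * J by (rule poly.subspace_scale[rotated])
    also have "cscale (1 / c k) (\<Sum>k\<in>insert k K. cscale (c k) (e k))
      = e k - (\<Sum>j\<in>K. cscale (- c j / c k) (e j))"
      using assms(1,3) c by (simp add: poly.scale_right_distrib poly.scale_sum_right
          sum_negf poly.scale_minus_left)
    finally show False using assms(4) by (meson)
  qed
  then have "(\<Sum>k\<in>K. cscale (c k) (e k)) \<in> J" using * assms(1,3) by simp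
  with assms(2) \<open>c k = 0\<close> show "\<forall>j\<in>insert k K. c j = 0" by (auto simp: indep_mod_def)
qed

lemma indep_mod_spans:
  assumes "finite K" "e ` K \<subseteq> graded_piece u" "indep_mod J K e" "hilbert_fun J u \<le> card K"
    and f: "f \<in> graded_piece u"
  shows "\<exists>c. f - (\<Sum>k\<in>K. cscale (c k) (e k)) \<in> J"
proof (rule ccontr)
  assume no: "\<nexists>c. f - (\<Sum>k\<in>K. cscale (c k) (e k)) \<in> J"
  \<comment> \<open>\<open>f\<close> receives the fresh index \<open>None\<close>. If the family did
    not reach \<open>f\<close>, the enlarged family would be independent with more members than the
    Hilbert function permits.\<close>
  define e' where "e' = case_option f e"
  have s: "(\<Sum>k\<in>Some ` K. cscale (c k) (e' k)) = (\<Sum>k\<in>K. cscale (c (Some k)) (e k))" for c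
    by (subst sum.reindex) (auto simp: e'_def)
  have "indep_mod J (insert None (Some ` K)) e'"
  proof (rule indep_mod_insert)
    show "indep_mod J (Some ` K) e'"
      using assms(3) unfolding indep_mod_def s by fastforce
    show "\<nexists>c. e' None - (\<Sum>k\<in>Some ` K. cscale (c k) (e' k)) \<in> J"
      unfolding s using no by (auto simp: e'_def)
  qed (use assms in auto)
  moreover have "e' ` insert None (Some ` K) \<subseteq> graded_piece u"
    using assms(2) f by (auto simp: e'_def)
  ultimately have "card (insert None (Some ` K)) \<le> hilbert_fun J u"
    using assms(1) by (intro card_le_hilbert_fun) auto
  then show False using assms(1,4) by (simp add: card_image)
qed

end

lemma hilbert_fun_antimono:
  assumes "poly.subspace J" "poly.subspace J'" "J \<inter> graded_piece u \<subseteq> J'"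
  shows "hilbert_fun J' u \<le> hilbert_fun J u"
proof -
  obtain e where e: "e ` {..<hilbert_fun J' u} \<subseteq> graded_piece u" "indep_mod J' {..<hilbert_fun J' u} e"
    using exists_hilbert_basis[OF assms(2)] by metis
  have "indep_mod J {..<hilbert_fun J' u} e"
    using e(2) sum_cscale_graded[OF e(1)] assms(3) unfolding indep_mod_def by blast
  from card_le_hilbert_fun[OF assms(1) _ e(1) this] show ?thesis by simp
qed

text \<open>A basis modulo \<open>J'\<close> in degree \<open>u\<close> is independent modulo the
  smaller \<open>J\<close> and spans there by the count; an element of \<open>J'\<close> then has
  only zero coordinates. Subspaces suffice, so \<open>Ann F\<close> can take the place of
  \<open>J'\<close>.\<close>

lemma hilbert_fun_eqD:
  assumes "poly.subspace J" "poly.subspace J'" "J \<inter> graded_piece u \<subseteq> J'"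
    "hilbert_fun J u \<le> hilbert_fun J' u"
  shows "J \<inter> graded_piece u = J' \<inter> graded_piece u"
proof -
  obtain e where e: "e ` {..<hilbert_fun J' u} \<subseteq> graded_piece u" "indep_mod J' {..<hilbert_fun J' u} e"
    using exists_hilbert_basis[OF assms(2)] by metis
  have i: "indep_mod J {..<hilbert_fun J' u} e"
    using e(2) sum_cscale_graded[OF e(1)] assms(3) unfolding indep_mod_def by blast
  have "f \<in> J" if f: "f \<in> J'" "f \<in> graded_piece u" for f
  proof -
    obtain c where c: "f - (\<Sum>k<hilbert_fun J' u. cscale (c k) (e k)) \<in> J"
      using indep_mod_spans[OF assms(1) _ e(1) i _ f(2)] assms(4) by auto
    let ?s = "\<Sum>k<hilbert_fun J' u. cscale (c k) (e k)"
    have "f - ?s \<in> J'"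
      using c poly.subspace_diff[OF subspace_graded_piece f(2) sum_cscale_graded[OF e(1)]] assms(3) by blast
    then have "f - (f - ?s) \<in> J'" using poly.subspace_diff[OF assms(2) f(1)] by blast
    then have "\<forall>k<hilbert_fun J' u. c k = 0" using e(2) by (auto simp: indep_mod_def)
    then have "?s = 0" by simp
    with c show ?thesis by simp
  qed
  then show ?thesis using assms(3) by blast
qed

section \<open>Nonzerodivisors modulo an ideal\<close>

definition nzd_mod :: "'a::comm_ring_1 set \<Rightarrow> 'a \<Rightarrow> bool" where
  "nzd_mod J g \<longleftrightarrow> (\<forall>f. f * g \<in> J \<longrightarrow> f \<in> J)"

lemma nzd_mod_mult: "nzd_mod J g \<Longrightarrow> nzd_mod J h \<Longrightarrow> nzd_mod J (g * h)"
  unfolding nzd_mod_def by (metis mult.assoc)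

lemma nzd_mod_1 [simp]: "nzd_mod J 1"
  by (simp add: nzd_mod_def)

lemma nzd_mod_power: "nzd_mod J g \<Longrightarrow> nzd_mod J (g ^ n)"
  by (induction n) (auto intro: nzd_mod_mult)

lemma nzd_indep_mod:
  assumes "nzd_mod J g" "indep_mod J K e"
  shows "indep_mod J K (\<lambda>k. e k * g)"
proof -
  have "(\<Sum>k\<in>K. cscale (c k) (e k * g)) = (\<Sum>k\<in>K. cscale (c k) (e k)) * g" for c
    by (simp add: sum_distrib_right cscale_mult_left)
  then show ?thesis using assms by (auto simp: indep_mod_def nzd_mod_def)
qed

lemma hilbert_fun_nzd_mono:
  assumes "poly.subspace J" "nzd_mod J g" "g \<in> graded_piece v"
  shows "hilbert_fun J u \<le> hilbert_fun J (u + v)"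
proof -
  obtain e where e: "e ` {..<hilbert_fun J u} \<subseteq> graded_piece u" "indep_mod J {..<hilbert_fun J u} e"
    using exists_hilbert_basis[OF assms(1)] by metis
  have "(\<lambda>k. e k * g) ` {..<hilbert_fun J u} \<subseteq> graded_piece (u + v)"
    using e(1) assms(3) mult_in_graded_piece by blast
  from card_le_hilbert_fun[OF assms(1) _ this nzd_indep_mod[OF assms(2) e(2)]] show ?thesis by simp
qed

text \<open>Multiplication by \<open>g\<close> is injective from the quotient in degree
  \<open>u\<close> to the quotient in degree \<open>u + v\<close>; when the target is not larger, it
  is onto.\<close>

lemma hilbert_fun_nzd_surj:
  assumes "poly.subspace J" "nzd_mod J g" "g \<in> graded_piece v"
    "hilbert_fun J (u + v) \<le> hilbert_fun J u" "f \<in> graded_piece (u + v)"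
  shows "\<exists>s\<in>graded_piece u. f - s * g \<in> J"
proof -
  obtain e where e: "e ` {..<hilbert_fun J u} \<subseteq> graded_piece u" "indep_mod J {..<hilbert_fun J u} e"
    using exists_hilbert_basis[OF assms(1)] by metis
  have "(\<lambda>k. e k * g) ` {..<hilbert_fun J u} \<subseteq> graded_piece (u + v)"
    using e(1) assms(3) mult_in_graded_piece by blast
  from indep_mod_spans[OF assms(1) _ this nzd_indep_mod[OF assms(2) e(2)] _ assms(5)] assms(4)
  obtain c where "f - (\<Sum>k<hilbert_fun J u. cscale (c k) (e k * g)) \<in> J" by auto
  then have "f - (\<Sum>k<hilbert_fun J u. cscale (c k) (e k)) * g \<in> J"
    by (simp add: sum_distrib_right cscale_mult_left)
  then show ?thesis using sum_cscale_graded[OF e(1)] by blast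
qed

section \<open>Linear forms that are nonzerodivisors modulo a saturated ideal\<close>

text \<open>One enumeration serves for the exponents on the moment curve, for matching frame
  coordinates with matrix rows, and for numbering the coordinate points.\<close>

definition idx :: "'n::finite \<Rightarrow> nat" where
  "idx = (SOME f. bij_betw f UNIV {..<CARD('n)})"

lemma bij_idx: "bij_betw (idx :: 'n::finite \<Rightarrow> nat) UNIV {..<CARD('n)}"
proof -
  have "\<exists>f :: 'n \<Rightarrow> nat. bij_betw f UNIV {..<CARD('n)}"
    using ex_bij_betw_finite_nat[of "UNIV :: 'n set"] by (auto simp: lessThan_atLeast0)
  then show ?thesis unfolding idx_def by (rule someI_ex)
qed

lemma idx_less [simp]: "idx (i :: 'n::finite) < CARD('n)"
  using bij_idx[where 'n='n] by (auto simp: bij_betw_def)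

lemma idx_eq_iff [simp]: "idx i = idx j \<longleftrightarrow> i = j"
  using bij_idx by (auto simp: bij_betw_def inj_on_def)

text \<open>The coefficient vectors run along the moment curve. By a Vandermonde argument a proper
  linear subspace contains only finitely many of these forms.\<close>

definition lin_form :: "axis \<Rightarrow> complex \<Rightarrow> 'n::finite cvar pol" where
  "lin_form a z = (\<Sum>i\<in>UNIV. cscale (z ^ idx i) (var (avar a i)))"

lemma var_graded: "var (avar a i) \<in> graded_piece (udeg a)"
  unfolding var_def by (rule single_in_graded_piece[OF mon_deg_avar])

lemma lin_form_graded: "lin_form a z \<in> graded_piece (udeg a)"
  unfolding lin_form_def by (rule sum_cscale_graded) (auto simp: var_graded)

lemma one_graded: "1 \<in> graded_piece 0"
  using single_in_graded_piece[of 0 0 1] by simp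

text \<open>Saturation with respect to the generators of the irrelevant ideal, which avoids handling
  its powers.\<close>

definition sat :: "'n::finite cvar pol set \<Rightarrow> bool" where
  "sat J \<longleftrightarrow> (\<forall>f. (\<forall>i j k. f * (var (Alpha i) * var (Beta j) * var (Gamma k)) \<in> J) \<longrightarrow> f \<in> J)"

text \<open>Every generator of the irrelevant ideal contains a variable of each group.\<close>

lemma sat_axis:
  assumes "sat J" "is_ideal J" "\<And>i. f * var (avar a i) \<in> J"
  shows "f \<in> J"
proof -
  have "f * (var (Alpha i) * var (Beta j) * var (Gamma k)) \<in> J" for i j k
  proof (cases a)
    case X1
    have "f * var (avar a i) * (var (Beta j) * var (Gamma k)) \<in> J"
      by (rule ideal_mult_right[OF assms(2,3)])
    then show ?thesis using X1 by (simp add: mult_ac)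
  next
    case X2
    have "f * var (avar a j) * (var (Alpha i) * var (Gamma k)) \<in> J"
      by (rule ideal_mult_right[OF assms(2,3)])
    then show ?thesis using X2 by (simp add: mult_ac)
  next
    case X3
    have "f * var (avar a k) * (var (Alpha i) * var (Beta j)) \<in> J"
      by (rule ideal_mult_right[OF assms(2,3)])
    then show ?thesis using X3 by (simp add: mult_ac)
  qed
  then show ?thesis using assms(1) unfolding sat_def by blast
qed

lemma is_ideal_colon: "is_ideal J \<Longrightarrow> is_ideal {b. f * b \<in> J}"
  by (rule is_idealI)
    (auto simp: ideal.subspace_0 distrib_left ideal.subspace_add mult.left_commute[of f] ideal_mult_left)

lemma ideal_gen_power_1_subset:
  assumes "is_ideal J" "G \<subseteq> J"
  shows "ideal_power (ideal_gen G) (Suc 0) \<subseteq> J"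
proof -
  have "ideal_gen G \<subseteq> J" using assms by (rule ideal.span_minimal[rotated])
  then have "{a * b |a b. a \<in> ideal_gen G \<and> b \<in> ideal_power (ideal_gen G) 0} \<subseteq> J"
    using assms(1) by (auto intro: ideal_mult_right)
  then show ?thesis using assms(1) by (simp add: ideal.span_minimal)
qed

text \<open>The exponent one is already a witness: the colon ideal of \<open>f\<close> contains the
  irrelevant ideal as soon as it contains the generators.\<close>

lemma saturationI:
  assumes "is_ideal J" "\<And>i j k. f * (var (Alpha i) * var (Beta j) * var (Gamma k)) \<in> J"
  shows "f \<in> saturation J irrelevant_ideal"
proof -
  have "ideal_power irrelevant_ideal (Suc 0) \<subseteq> {b. f * b \<in> J}"
    unfolding irrelevant_ideal_def using assms
    by (intro ideal_gen_power_1_subset is_ideal_colon) auto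
  then show ?thesis unfolding saturation_def by blast
qed

lemma B_saturated_imp_sat: "is_ideal J \<Longrightarrow> B_saturated J \<Longrightarrow> sat J"
  using saturationI[of J] unfolding B_saturated_def sat_def by blast

lemma tridegree_induct [case_names zero add]:
  assumes "P 0" "\<And>w a. P w \<Longrightarrow> P (w + udeg a)"
  shows "P (w :: tridegree)"
proof -
  have "P (i, j, k)" for i j k
  proof (induction k)
    case 0
    show ?case
    proof (induction j)
      case 0
      show ?case
      proof (induction i)
        case 0 show ?case using assms(1) by (simp add: zero_prod_def)
      next
        case (Suc i) from assms(2)[OF this, of X1] show ?case by simp
      qed
    next
      case (Suc j) from assms(2)[OF this, of X2] show ?case by simp
    qed
  next
    case (Suc k) from assms(2)[OF this, of X3] show ?case by simp
  qed
  then show ?thesis by (cases w) auto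
qed

text \<open>This carries a difference between two ideals up into any higher degree, one variable at
  a time.\<close>

lemma sat_lift_degree:
  assumes "sat J" "is_ideal J" "f \<notin> J"
  shows "\<exists>g\<in>graded_piece w. f * g \<notin> J"
proof (induction w rule: tridegree_induct)
  case zero
  show ?case using assms(3) one_graded by (intro bexI[of _ 1]) auto
next
  case (add w a)
  then obtain g where g: "g \<in> graded_piece w" "f * g \<notin> J" by blast
  then obtain i where "f * g * var (avar a i) \<notin> J" using sat_axis assms(1,2) by blast
  then show ?case using mult_in_graded_piece[OF g(1) var_graded[of a i]]
    by (intro bexI[of _ "g * var (avar a i)"]) (auto simp: mult.assoc)
qed

definition freq_le :: "'n::finite cvar pol set \<Rightarrow> nat \<Rightarrow> bool" where
  "freq_le J c \<longleftrightarrow> (\<forall>k0. \<exists>k\<ge>k0. hilbert_fun J (k, k, k) \<le> c)"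

text \<open>The limit inferior of the Hilbert function along the diagonal. The saturated ideals met
  in the induction are not known to have an eventually constant Hilbert function, but this number
  only requires a bound attained infinitely often.\<close>

definition hliminf :: "'n::finite cvar pol set \<Rightarrow> nat" where
  "hliminf J = (LEAST c. freq_le J c)"

lemma freq_le_mono:
  assumes "is_ideal J" "is_ideal N" "J \<subseteq> N" "freq_le J c"
  shows "freq_le N c"
  using assms(4) hilbert_fun_antimono[OF subspace_of_ideal[OF assms(1)] subspace_of_ideal[OF assms(2)]]
    assms(3) unfolding freq_le_def by (meson le_trans le_infI1)

lemma hliminf_less:
  assumes J: "homogeneous_ideal J" "sat J" and N: "homogeneous_ideal N" and sub: "J \<subset> N"
    and b: "freq_le J c"
  shows "hliminf N < hliminf J"
proof -
  note ij = homogeneous_is_ideal[OF J(1)] and iN = homogeneous_is_ideal[OF N]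
  have c1: "freq_le J (hliminf J)" unfolding hliminf_def using b by (rule LeastI)
  obtain f0 where f0: "f0 \<in> N" "f0 \<notin> J" using sub by blast
  then obtain u where u: "hom_component u f0 \<notin> J" using homogeneous_ideal_iff[OF J(1)] by blast
  define f where "f = hom_component u f0"
  have f: "f \<in> N" "f \<notin> J" "f \<in> graded_piece u"
    using f0 u homogeneous_ideal_iff[OF N, of f0] hom_component_in unfolding f_def by blast+
  obtain p q r where upqr: "u = (p, q, r)" by (cases u) auto
  have less: "hilbert_fun N (k, k, k) < hilbert_fun J (k, k, k)" if k: "k \<ge> p + q + r" for k
  proof -
    \<comment> \<open>The bound on \<open>k\<close> makes these truncated subtractions exact, so the
      product lands on the diagonal.\<close>
    obtain g where g: "g \<in> graded_piece (k - p, k - q, k - r)" "f * g \<notin> J"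
      using sat_lift_degree[OF J(2) ij f(2)] by blast
    have "u + (k - p, k - q, k - r) = (k, k, k)" using k upqr by simp
    then have fg: "f * g \<in> graded_piece (k, k, k)" using mult_in_graded_piece[OF f(3) g(1)] by simp
    have "f * g \<in> N" using f(1) iN by (rule ideal_mult_right[rotated])
    then have "J \<inter> graded_piece (k, k, k) \<noteq> N \<inter> graded_piece (k, k, k)" using fg g(2) by blast
    then show ?thesis
      using hilbert_fun_eqD[OF subspace_of_ideal[OF ij] subspace_of_ideal[OF iN], of "(k, k, k)"] sub
      by (metis inf.coboundedI1 leI psubset_imp_subset)
  qed
  \<comment> \<open>Positivity is proved along with the bound because the subtraction of one is
    truncated.\<close>
  have "freq_le N (hliminf J - 1) \<and> hliminf J > 0"
    unfolding freq_le_def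
  proof (intro conjI allI)
    fix k0
    obtain k where k: "k \<ge> max k0 (p + q + r)" "hilbert_fun J (k, k, k) \<le> hliminf J"
      using c1 unfolding freq_le_def by blast
    with less[of k] show "\<exists>k\<ge>k0. hilbert_fun N (k, k, k) \<le> hliminf J - 1"
      by (intro exI[of _ k]) auto
  next
    obtain k where k: "k \<ge> p + q + r" "hilbert_fun J (k, k, k) \<le> hliminf J"
      using c1 unfolding freq_le_def by blast
    with less[of k] show "hliminf J > 0" by auto
  qed
  then show ?thesis unfolding hliminf_def[of N]
    by (metis Least_le Suc_pred' less_Suc_eq_le)
qed

section \<open>Linear forms on the moment curve\<close>

lemma const_power: "(single 0 z :: 'v pol) ^ k = single 0 (z ^ k)"
  by (induction k) (simp_all add: mult_single)

text \<open>A polynomial in the scalar \<open>z\<close> with values in \<open>J\<close> for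
  infinitely many \<open>z\<close> has its coefficients in \<open>J\<close>. Divided differences
  isolate the top coefficient, and the infinite set \<open>Z\<close> can afford to lose the base
  point at each stage.\<close>

lemma ideal_vandermonde:
  fixes v :: "nat \<Rightarrow> 'v pol"
  assumes J: "is_ideal J"
  shows "infinite Z \<Longrightarrow> (\<And>z. z \<in> Z \<Longrightarrow> (\<Sum>i<n. v i * single 0 z ^ i) \<in> J) \<Longrightarrow> i < n \<Longrightarrow> v i \<in> J"
proof (induction n arbitrary: v Z i)
  case (Suc n)
  have top: "v n \<in> J"
  proof (cases "n = 0")
    case True
    obtain z where "z \<in> Z" using Suc.prems(1) by fastforce
    then show ?thesis using Suc.prems(2)[of z] True by simp
  next
    case False
    obtain z0 where z0: "z0 \<in> Z" using Suc.prems(1) by fastforce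
    \<comment> \<open>Coefficients of the difference of the values at \<open>z\<close> and
      \<open>z0\<close> after division by \<open>z - z0\<close>; the last of them is
      \<open>v n\<close>.\<close>
    let ?w = "\<lambda>j. \<Sum>i=Suc j..n. v i * single 0 z0 ^ (i - Suc j)"
    have "(\<Sum>j<n. ?w j * single 0 z ^ j) \<in> J" if z: "z \<in> Z - {z0}" for z
    proof -
      have "(\<Sum>i\<le>n. v i * single 0 z ^ i) - (\<Sum>i\<le>n. v i * single 0 z0 ^ i) \<in> J"
        using Suc.prems(2)[of z] Suc.prems(2)[of z0] z z0
        by (intro ideal.subspace_diff[OF J]) (simp_all add: lessThan_Suc_atMost)
      then have "(single 0 z - single 0 z0) * (\<Sum>j<n. ?w j * single 0 z ^ j) \<in> J"
        by (simp only: sub_polyfun sum_distrib_right)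
      then have "single 0 (1 / (z - z0)) * ((single 0 z - single 0 z0) * (\<Sum>j<n. ?w j * single 0 z ^ j)) \<in> J"
        by (rule ideal_mult_left[OF J])
      moreover have "single 0 (1 / (z - z0)) * (single 0 z - single 0 z0) = (1 :: 'v pol)"
        using z by (simp add: mult_single flip: single_diff)
      ultimately show ?thesis by (simp flip: mult.assoc)
    qed
    then have "?w (n - 1) \<in> J"
      using Suc.prems(1) False by (intro Suc.IH[of "Z - {z0}" ?w "n - 1"]) auto
    then show ?thesis using False by simp
  qed
  show ?case
  proof (cases "i = n")
    case False
    have "(\<Sum>i<n. v i * single 0 z ^ i) \<in> J" if "z \<in> Z" for z
    proof -
      have "(\<Sum>i<Suc n. v i * single 0 z ^ i) - v n * single 0 z ^ n \<in> J"
        using Suc.prems(2)[OF that] top by (intro ideal.subspace_diff[OF J] ideal_mult_right[OF J])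
      then show ?thesis by simp
    qed
    from Suc.IH[OF Suc.prems(1) this, of i] Suc.prems(3) False show ?thesis by simp
  qed (use top in simp)
qed simp

lemma the_inv_idx [simp]: "the_inv_into UNIV idx (idx i) = i"
  by (rule the_inv_into_f_f) (auto simp: inj_on_def)

lemma mult_lin_form:
  fixes f :: "'n::finite cvar pol"
  shows "f * lin_form a z
    = (\<Sum>k<CARD('n). (f * var (avar a (the_inv_into UNIV idx k))) * single 0 z ^ k)"
proof -
  have "f * lin_form a z = (\<Sum>i\<in>UNIV. (f * var (avar a i)) * single 0 z ^ idx i)"
    unfolding lin_form_def sum_distrib_left
    by (intro sum.cong) (simp_all add: cscale_def const_power mult_ac)
  also have "\<dots> = (\<Sum>i\<in>(UNIV :: 'n set). (f * var (avar a (the_inv_into UNIV idx (idx i)))) * single 0 z ^ idx i)"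
    by simp
  also have "\<dots> = (\<Sum>k<CARD('n). (f * var (avar a (the_inv_into UNIV idx k))) * single 0 z ^ k)"
    by (rule sum.reindex_bij_betw[OF bij_idx])
  finally show ?thesis .
qed

lemma infinite_lin_form:
  fixes f :: "'n::finite cvar pol"
  assumes "is_ideal J" "infinite {z. f * lin_form a z \<in> J}"
  shows "f * var (avar a i) \<in> J"
proof -
  have "f * var (avar a (the_inv_into UNIV idx (idx i))) \<in> J"
    by (rule ideal_vandermonde[OF assms, where n = "CARD('n)"
        and v = "\<lambda>k. f * var (avar a (the_inv_into UNIV idx k))"]) (auto simp flip: mult_lin_form)
  then show ?thesis by simp
qed

lemma homogeneous_colon:
  assumes "homogeneous_ideal J" "homogeneous_ideal N" "g \<in> graded_piece v"
  shows "homogeneous_ideal (N \<inter> {f. f * g \<in> J})"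
  unfolding homogeneous_ideal_def
proof (intro conjI ballI allI)
  have "is_ideal {f. g * f \<in> J}" using assms(1) by (intro is_ideal_colon homogeneous_is_ideal)
  then show "is_ideal (N \<inter> {f. f * g \<in> J})"
    using homogeneous_is_ideal[OF assms(2)] by (simp add: mult.commute ideal.subspace_inter)
  fix p u assume "p \<in> N \<inter> {f. f * g \<in> J}"
  then show "hom_component u p \<in> N \<inter> {f. f * g \<in> J}"
    using homogeneous_ideal_iff[OF assms(1), of "p * g"] homogeneous_ideal_iff[OF assms(2), of p]
    unfolding Int_iff mem_Collect_eq hom_component_mult[OF assms(3), symmetric] by blast
qed

lemma sat_colon:
  assumes "sat J" "sat N"
  shows "sat (N \<inter> {f. f * g \<in> J})"
  unfolding sat_def
proof (intro allI impI)
  fix f assume *: "\<forall>i j k. f * (var (Alpha i) * var (Beta j) * var (Gamma k)) \<in> N \<inter> {f. f * g \<in> J}"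
  then have "f \<in> N" using assms(2) by (auto simp: sat_def)
  moreover have "f * g \<in> J"
  proof -
    have "(f * g) * (var (Alpha i) * var (Beta j) * var (Gamma k)) \<in> J" for i j k
    proof -
      have "f * (var (Alpha i) * var (Beta j) * var (Gamma k)) * g \<in> J" using * by blast
      then show ?thesis by (simp add: mult_ac)
    qed
    then show ?thesis using assms(1) by (auto simp: sat_def)
  qed
  ultimately show "f \<in> N \<inter> {f. f * g \<in> J}" by simp
qed

lemma homogeneous_UNIV: "homogeneous_ideal UNIV"
  by (simp add: homogeneous_ideal_def)

text \<open>Induction along a chain of saturated ideals. If \<open>N\<close> is minimal above \<open>J\<close>, then
  \<open>N \<inter> (J : l)\<close> is \<open>J\<close> or \<open>N\<close> for every linear form \<open>l\<close>, and the forms with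
  \<open>l N \<subseteq> J\<close> lie in a proper linear subspace, which meets the moment curve finitely often.\<close>

lemma finite_zero_divisors:
  fixes J :: "'n::finite cvar pol set"
  assumes "homogeneous_ideal J" "sat J" "freq_le J c"
  shows "finite {z. \<not> nzd_mod J (lin_form a z)}"
  using assms
proof (induction "hliminf J" arbitrary: J rule: less_induct)
  case less
  note J = less.prems and ij = homogeneous_is_ideal[OF less.prems(1)]
  show ?case
  proof (cases "J = UNIV")
    case True
    then show ?thesis by (simp add: nzd_mod_def)
  next
    case False
    let ?P = "\<lambda>N. homogeneous_ideal N \<and> sat N \<and> J \<subset> N"
    have "?P UNIV" using False homogeneous_UNIV by (auto simp: sat_def)
    moreover have "\<forall>N. ?P N \<longrightarrow> hliminf N < hliminf J"
      using hliminf_less J by blast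
    \<comment> \<open>Maximal \<open>hliminf\<close> makes \<open>N\<close> minimal above
      \<open>J\<close>: by \<open>hliminf_less\<close>, a saturated ideal strictly between the two
      would have a larger value.\<close>
    ultimately obtain N where N: "?P N" and max: "\<forall>N'. ?P N' \<longrightarrow> hliminf N' \<le> hliminf N"
      using ex_has_greatest_nat[of ?P UNIV hliminf "hliminf J"] by auto
    have fN: "freq_le N c"
      using freq_le_mono[OF ij homogeneous_is_ideal] N J(3) by blast
    have "finite {z. \<not> nzd_mod N (lin_form a z)}"
      using less.hyps[of N] N hliminf_less[OF J(1,2)] J(3) fN by blast
    moreover have "finite {z. \<forall>f\<in>N. f * lin_form a z \<in> J}"
    proof (rule ccontr)
      assume inf: "infinite {z. \<forall>f\<in>N. f * lin_form a z \<in> J}"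
      obtain f where f: "f \<in> N" "f \<notin> J" using N by blast
      have "infinite {z. f * lin_form a z \<in> J}"
        by (rule infinite_super[OF _ inf]) (use f in auto)
      then have "f \<in> J" using infinite_lin_form[OF ij] sat_axis[OF J(2) ij] by blast
      with f show False by simp
    qed
    \<comment> \<open>If \<open>f * lin_form a z\<close> lies in \<open>J\<close>, it lies in
      \<open>N\<close>, so \<open>f\<close> is in \<open>N\<close> and hence in the colon part
      \<open>N'\<close>. Minimality of \<open>N\<close> identifies \<open>N'\<close> with
      \<open>J\<close>.\<close>
    moreover have "nzd_mod J (lin_form a z)"
      if z: "nzd_mod N (lin_form a z)" "\<not> (\<forall>f\<in>N. f * lin_form a z \<in> J)" for z
    proof -
      define N' where "N' = N \<inter> {f. f * lin_form a z \<in> J}"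
      have h: "homogeneous_ideal N'" "sat N'" unfolding N'_def
        using N J by (auto intro: homogeneous_colon lin_form_graded sat_colon)
      have sub: "J \<subseteq> N'" using N ij by (auto simp: N'_def ideal_mult_right)
      have ps: "N' \<subset> N" using z(2) by (auto simp: N'_def)
      have "N' = J"
      proof (rule ccontr)
        assume "N' \<noteq> J"
        then have "?P N'" using h sub by blast
        then have "hliminf N' \<le> hliminf N" using max by blast
        moreover have "hliminf N < hliminf N'"
          using hliminf_less[OF h _ ps] N freq_le_mono[OF ij homogeneous_is_ideal[OF h(1)] sub J(3)]
          by blast
        ultimately show False by simp
      qed
      moreover have "J \<subseteq> N" using N by blast
      ultimately show ?thesis using z(1) unfolding nzd_mod_def N'_def by blast
    qed
    ultimately show ?thesis
      by (rule_tac finite_subset[of _ "{z. \<not> nzd_mod N (lin_form a z)} \<union> {z. \<forall>f\<in>N. f * lin_form a z \<in> J}"]) auto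
  qed
qed

lemma exists_nzd_lin_form:
  assumes "homogeneous_ideal J" "sat J" "freq_le J c"
  shows "\<exists>l\<in>graded_piece (udeg a). nzd_mod J l"
proof -
  have "\<exists>z. nzd_mod J (lin_form a z)"
    using finite_zero_divisors[OF assms, of a] infinite_UNIV_char_0[where 'a=complex]
    by (metis (mono_tags, lifting) UNIV_eq_I mem_Collect_eq)
  then show ?thesis using lin_form_graded by blast
qed

section \<open>Frames\<close>

lemma frame_map_superset:
  "finite A \<Longrightarrow> keys f \<subseteq> A \<Longrightarrow> frame_map \<phi> f i = (\<Sum>t\<in>A. lookup f t * \<phi> (t, i))"
  unfolding frame_map_def by (rule sum.mono_neutral_left) (auto simp: in_keys_iff)

lemma frame_map_add: "frame_map \<phi> (f + g) i = frame_map \<phi> f i + frame_map \<phi> g i"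
proof -
  have "keys (f + g) \<subseteq> keys f \<union> keys g" by (rule Poly_Mapping.keys_add)
  then show ?thesis
    using frame_map_superset[of "keys f \<union> keys g" "f + g" \<phi> i]
      frame_map_superset[of "keys f \<union> keys g" f \<phi> i] frame_map_superset[of "keys f \<union> keys g" g \<phi> i]
    by (simp add: lookup_add distrib_right sum.distrib)
qed

lemma frame_map_0 [simp]: "frame_map \<phi> 0 i = 0"
  by (simp add: frame_map_def)

lemma frame_map_cscale: "frame_map \<phi> (cscale c f) i = c * frame_map \<phi> f i"
proof -
  have "keys (cscale c f) \<subseteq> keys f" by (auto simp: in_keys_iff lookup_cscale)
  then show ?thesis
    using frame_map_superset[of "keys f" "cscale c f" \<phi> i]
    by (simp add: frame_map_def lookup_cscale sum_distrib_left mult.assoc)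
qed

lemma frame_map_sum: "frame_map \<phi> (\<Sum>k\<in>K. f k) i = (\<Sum>k\<in>K. frame_map \<phi> (f k) i)"
  by (induction K rule: infinite_finite_induct) (simp_all add: frame_map_add)

lemma frame_map_diff: "frame_map \<phi> (f - g) i = frame_map \<phi> f i - frame_map \<phi> g i"
  using frame_map_add[of \<phi> "f - g" g i] by simp

lemma framesD:
  assumes "\<phi> \<in> frames D h J" "u \<in> D"
  shows "\<exists>f\<in>graded_piece u. \<forall>i<h u. frame_map \<phi> f i = c i"
    and "f \<in> graded_piece u \<Longrightarrow> f \<in> J \<longleftrightarrow> (\<forall>i<h u. frame_map \<phi> f i = 0)"
  using assms by (auto simp: frames_def)

text \<open>A frame induces an isomorphism from the quotient in degree \<open>u\<close> onto the
  space with \<open>h u\<close> coordinates; preimages of the unit vectors form a basis modulo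
  \<open>J\<close>.\<close>

lemma hilbert_fun_frames:
  fixes J :: "'n::finite cvar pol set"
  assumes J: "poly.subspace J" and \<phi>: "\<phi> \<in> frames D h J" "u \<in> D"
  shows "hilbert_fun J u = h u"
proof -
  have "\<exists>f\<in>graded_piece u. \<forall>i<h u. frame_map \<phi> f i = (if i = k then 1 else 0)" for k
    using framesD(1)[OF \<phi>, of "\<lambda>i. if i = k then 1 else 0"] by simp
  then obtain e where e: "\<And>k. e k \<in> graded_piece u"
    "\<And>k i. i < h u \<Longrightarrow> frame_map \<phi> (e k) i = (if i = k then 1 else 0)"
    by metis
  have sub: "e ` K \<subseteq> graded_piece u" for K using e by auto
  have fm: "frame_map \<phi> (\<Sum>k<h u. cscale (c k) (e k)) i = c i" if "i < h u" for c i
    using that by (simp add: frame_map_sum frame_map_cscale e if_distrib cong: if_cong)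
  show ?thesis
  proof (rule antisym)
    have "\<exists>c. f - (\<Sum>k<h u. cscale (c k) (e k)) \<in> J" if f: "f \<in> graded_piece u" for f
    proof
      have "f - (\<Sum>k<h u. cscale (frame_map \<phi> f k) (e k)) \<in> graded_piece u"
        using f sub by (intro poly.subspace_diff[OF subspace_graded_piece] sum_cscale_graded)
      then show "f - (\<Sum>k<h u. cscale (frame_map \<phi> f k) (e k)) \<in> J"
        using framesD(2)[OF \<phi>] by (simp add: frame_map_diff fm)
    qed
    then show "hilbert_fun J u \<le> h u"
      using hilbert_fun_le_card[OF J, of "{..<h u}" u e] sub by auto
    have "indep_mod J {..<h u} e"
      unfolding indep_mod_def
    proof (intro allI impI)
      fix c assume "(\<Sum>k<h u. cscale (c k) (e k)) \<in> J"
      then have "\<forall>i<h u. frame_map \<phi> (\<Sum>k<h u. cscale (c k) (e k)) i = 0"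
        using framesD(2)[OF \<phi> sum_cscale_graded[OF sub]] by blast
      then show "\<forall>k\<in>{..<h u}. c k = 0" using fm by auto
    qed
    then show "h u \<le> hilbert_fun J u"
      using card_le_hilbert_fun[OF J, of "{..<h u}" e u] sub by auto
  qed
qed

section \<open>Hilbert functions in the smallest degrees\<close>

lemma mon_deg_eq_0_iff: "mon_deg t = 0 \<longleftrightarrow> (t :: 'n::finite cvar mon) = 0"
proof
  assume t: "mon_deg t = 0"
  show "t = 0"
  proof (rule poly_mapping_eqI)
    fix v :: "'n cvar"
    obtain a i where "v = avar a i" by (rule cvar_eq_avar)
    then show "lookup t v = lookup 0 v" using lookup_le_coord_mon_deg[of t a i] t by simp
  qed
qed simp

lemma mon_factor:
  assumes "coord a (mon_deg t) > 0"
  shows "\<exists>i s. t = single (avar a i) 1 + s"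
proof -
  obtain i where "lookup t (avar a i) \<noteq> 0"
    using assms unfolding coord_mon_deg by (metis less_numeral_extra(3) sum.neutral)
  then have "t = single (avar a i) 1 + (t - single (avar a i) 1)"
    by (intro poly_mapping_eqI) (auto simp: lookup_add lookup_minus lookup_single when_def)
  then show ?thesis by blast
qed

lemma mon_deg_eq_udegD: "mon_deg t = udeg a \<Longrightarrow> \<exists>i. t = single (avar a i) 1"
proof -
  assume t: "mon_deg t = udeg a"
  then have "coord a (mon_deg t) > 0" by (simp add: coord_udeg)
  then obtain i s where s: "t = single (avar a i) 1 + s" using mon_factor by blast
  then have "udeg a = udeg a + mon_deg s" using t mon_deg_avar[of a i] by (simp add: mon_deg_add)
  then have "s = 0" by (simp flip: mon_deg_eq_0_iff)
  with s show ?thesis by auto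
qed

lemma lookup_var: "lookup (var v) t = (if t = single v 1 then 1 else 0)"
  by (auto simp: var_def lookup_single when_def)

lemma single_1_eq_iff [simp]: "single v (Suc 0) = single w (Suc 0) \<longleftrightarrow> v = w"
  by (metis lookup_single_eq lookup_single_not_eq nat.distinct(1))

lemma lookup_sum_vars:
  "lookup (\<Sum>i\<in>UNIV. cscale (c i) (var (avar a i))) (single (avar a j) 1) = c (j :: 'n::finite)"
  by (simp add: lookup_sum lookup_cscale lookup_var if_distrib cong: if_cong)

lemma sum_vars_graded: "(\<Sum>i\<in>UNIV. cscale (c i) (var (avar a i))) \<in> graded_piece (udeg a)"
  by (rule sum_cscale_graded) (auto simp: var_graded)

lemma graded_udeg_expand:
  assumes "f \<in> graded_piece (udeg a)"
  shows "f = (\<Sum>i\<in>UNIV. cscale (lookup f (single (avar a i) 1)) (var (avar a i)))"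
proof (rule poly_mapping_eqI)
  fix t
  show "lookup f t = lookup (\<Sum>i\<in>UNIV. cscale (lookup f (single (avar a i) 1)) (var (avar a i))) t"
  proof (cases "mon_deg t = udeg a")
    case True
    then obtain j where "t = single (avar a j) 1" using mon_deg_eq_udegD by blast
    then show ?thesis by (simp only: lookup_sum_vars)
  next
    case False
    have 0: "lookup p t = 0" if "p \<in> graded_piece (udeg a)" for p
      using that False unfolding graded_piece_iff by blast
    show ?thesis unfolding 0[OF assms] 0[OF sum_vars_graded] ..
  qed
qed

lemma sum_vars_eq_0_iff:
  "(\<Sum>i\<in>UNIV. cscale (c i) (var (avar a i))) = 0 \<longleftrightarrow> (\<forall>i :: 'n::finite. c i = 0)"
  using lookup_sum_vars[of c a] by auto

lemma hilbert_fun_udeg: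
  fixes J :: "'n::finite cvar pol set"
  assumes J: "poly.subspace J" "J \<inter> graded_piece (udeg a) \<subseteq> {0}"
  shows "hilbert_fun J (udeg a) = CARD('n)"
proof (rule antisym)
  have sub: "(\<lambda>i. var (avar a i)) ` UNIV \<subseteq> graded_piece (udeg a)" by (auto simp: var_graded)
  have "\<exists>c. f - (\<Sum>i\<in>UNIV. cscale (c i) (var (avar a i))) \<in> J" if "f \<in> graded_piece (udeg a)" for f
    using poly.subspace_0[OF J(1)] right_minus_eq[THEN iffD2, OF graded_udeg_expand[OF that]]
    by (metis (no_types))
  then show "hilbert_fun J (udeg a) \<le> CARD('n)"
    using hilbert_fun_le_card[OF J(1), of UNIV "udeg a" "\<lambda>i. var (avar a i)"] sub by simp
  have "indep_mod J UNIV (\<lambda>i. var (avar a i) :: 'n cvar pol)"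
    unfolding indep_mod_def
  proof (intro allI impI)
    fix c assume "(\<Sum>i\<in>UNIV. cscale (c i) (var (avar a i))) \<in> J"
    then have "(\<Sum>i\<in>UNIV. cscale (c i) (var (avar a i))) = (0 :: 'n cvar pol)"
      using J(2) sum_vars_graded[of c a] by blast
    then show "\<forall>i\<in>UNIV. c i = 0" unfolding sum_vars_eq_0_iff by simp
  qed
  then show "CARD('n) \<le> hilbert_fun J (udeg a)"
    using card_le_hilbert_fun[OF J(1) _ sub] by simp
qed

lemma graded_0_expand:
  assumes "f \<in> graded_piece 0"
  shows "f = cscale (lookup f 0) 1"
  by (rule poly_mapping_eqI)
    (use assms in \<open>auto simp: graded_piece_iff mon_deg_eq_0_iff lookup_cscale lookup_one when_def\<close>)

lemma hilbert_fun_0: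
  fixes J :: "'n::finite cvar pol set"
  assumes J: "is_ideal J" "1 \<notin> J"
  shows "hilbert_fun J 0 = 1"
proof (rule antisym)
  have sub: "(\<lambda>_. 1 :: 'n cvar pol) ` {()} \<subseteq> graded_piece 0" by (auto simp: one_graded)
  have "\<exists>c. f - (\<Sum>k\<in>{()}. cscale (c k) 1) \<in> J" if "f \<in> graded_piece 0" for f :: "'n cvar pol"
    using graded_0_expand[OF that] ideal.subspace_0[OF J(1)]
    by (intro exI[of _ "\<lambda>_. lookup f 0"]) simp
  then show "hilbert_fun J 0 \<le> 1"
    using hilbert_fun_le_card[OF subspace_of_ideal[OF J(1)], of "{()}" 0 "\<lambda>_. 1"] sub by simp
  have "c = 0" if "cscale c 1 \<in> J" for c
  proof (rule ccontr)
    assume "c \<noteq> 0"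
    then have "cscale (1 / c) (cscale c 1) = (1 :: 'n cvar pol)" by (simp add: poly.scale_scale)
    then show False using ideal_cscale[OF J(1) that, of "1 / c"] J(2) by simp
  qed
  then have "indep_mod J {()} (\<lambda>_. 1)" by (auto simp: indep_mod_def)
  then show "1 \<le> hilbert_fun J 0"
    using card_le_hilbert_fun[OF subspace_of_ideal[OF J(1)] _ sub] by simp
qed

lemma hilbert_fun_zero_ideal:
  "hilbert_fun ({0} :: 'n cvar pol set) u = cdim (graded_piece u :: 'n::finite cvar pol set)"
proof -
  have "{0} \<inter> graded_piece u = ({0} :: 'n cvar pol set)"
    using poly.subspace_0[OF subspace_graded_piece[of u]] by auto
  moreover have "cdim ({0} :: 'n cvar pol set) = 0"
    using poly.dim_le_card[of "{0}" "{}"] by simp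
  ultimately show ?thesis by (simp add: hilbert_fun_def)
qed

section \<open>Hilbert functions in the presence of linear nonzerodivisors\<close>

lemma exists_nzd_degree:
  assumes "\<And>a. l a \<in> graded_piece (udeg a)" "\<And>a. nzd_mod J (l a)"
  shows "\<exists>g\<in>graded_piece w. nzd_mod J g"
proof (induction w rule: tridegree_induct)
  case zero
  show ?case using one_graded by (intro bexI[of _ 1]) auto
next
  case (add w a)
  then show ?case using assms mult_in_graded_piece nzd_mod_mult by blast
qed

lemma nonzero_tridegree: "u \<noteq> 0 \<Longrightarrow> \<exists>a w. u = udeg a + w"
proof -
  assume "u \<noteq> 0"
  then obtain a where "coord a u \<noteq> 0" using tridegree_eqI[of u 0] by auto
  then have "u = udeg a + (u - udeg a)"
    by (cases u; cases a) auto
  then show ?thesis by blast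
qed

text \<open>For \<open>r = CARD('n)\<close> this is the generic Hilbert function, since only the
  piece of degree zero has dimension below \<open>CARD('n)\<close>.\<close>

definition hfun :: "nat \<Rightarrow> tridegree \<Rightarrow> nat" where
  "hfun r u = (if u = 0 then 1 else r)"

abbreviation degs_ge :: "nat \<Rightarrow> tridegree set" where
  "degs_ge r \<equiv> {(a, b, c). r \<le> a \<and> r \<le> b \<and> r \<le> c}"

context
  fixes J :: "'n::finite cvar pol set" and l :: "axis \<Rightarrow> 'n cvar pol"
  assumes J: "homogeneous_ideal J"
    and l: "\<And>a. l a \<in> graded_piece (udeg a)" "\<And>a. nzd_mod J (l a)"
    and J1: "\<And>a. J \<inter> graded_piece (udeg a) \<subseteq> {0}"
begin

lemma one_notin: "1 \<notin> J"
proof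
  assume "1 \<in> J"
  then have "var (avar X1 undefined) \<in> J"
    using ideal_mult_left[OF homogeneous_is_ideal[OF J], of 1 "var (avar X1 undefined)"] by simp
  then have "var (avar X1 undefined) = (0 :: 'n cvar pol)"
    using J1[of X1] var_graded[of X1 undefined] by blast
  then have "lookup (var (avar X1 undefined) :: 'n cvar pol) (single (avar X1 undefined) 1) = 0"
    by simp
  then show False by (simp add: lookup_var)
qed

lemma hilbert_fun_le_add: "hilbert_fun J u \<le> hilbert_fun J (u + w)"
  using exists_nzd_degree[OF l, of w] hilbert_fun_nzd_mono[OF subspace_of_ideal[OF homogeneous_is_ideal[OF J]]]
  by blast

lemma card_le_hilbert_fun_nonzero: "u \<noteq> 0 \<Longrightarrow> CARD('n) \<le> hilbert_fun J u"
  using nonzero_tridegree[of u] hilbert_fun_le_add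
    hilbert_fun_udeg[OF subspace_of_ideal[OF homogeneous_is_ideal[OF J]] J1] by metis

text \<open>Adding \<open>(r, r, r)\<close> moves any degree into the region where the value is
  known, so monotonicity bounds the whole function by \<open>r\<close>; the absence of linear forms
  gives the opposite bound. The lemma serves the limit ideal as well as the ideals of points near
  it.\<close>

lemma hilbert_fun_of_bound:
  assumes "\<And>u. u \<in> degs_ge r \<Longrightarrow> hilbert_fun J u = r" "r \<le> CARD('n)"
  shows "r = CARD('n)" "hilbert_fun J = hfun CARD('n)"
    "generic_hilbert_fun TYPE('n) CARD('n) = hfun CARD('n)"
proof -
  have le: "hilbert_fun J u \<le> r" for u
    using hilbert_fun_le_add[of u "(r, r, r)"] assms(1)[of "u + (r, r, r)"] by (cases u) auto
  from le[of "udeg X1"] card_le_hilbert_fun_nonzero[of "udeg X1"] assms(2)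
  show r: "r = CARD('n)" by (simp add: zero_prod_def)
  show h: "hilbert_fun J = hfun CARD('n)"
  proof
    fix u
    show "hilbert_fun J u = hfun CARD('n) u"
      using le[of u] card_le_hilbert_fun_nonzero[of u] r
        hilbert_fun_0[OF homogeneous_is_ideal[OF J] one_notin] by (auto simp: hfun_def)
  qed
  have s0: "is_ideal ({0} :: 'n cvar pol set)" by (rule ideal.subspace_single_0)
  show "generic_hilbert_fun TYPE('n) CARD('n) = hfun CARD('n)"
  proof
    fix u
    have "hilbert_fun J u \<le> hilbert_fun ({0} :: 'n cvar pol set) u"
      using homogeneous_is_ideal[OF J] s0
      by (intro hilbert_fun_antimono subspace_of_ideal) (auto simp: ideal.subspace_0)
    moreover have "hilbert_fun ({0} :: 'n cvar pol set) 0 = cdim (graded_piece 0 :: 'n cvar pol set)"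
      by (rule hilbert_fun_zero_ideal)
    moreover have "hilbert_fun ({0} :: 'n cvar pol set) 0 = 1"
      by (rule hilbert_fun_0[OF s0]) simp
    moreover have "CARD('n) \<ge> 1" using zero_less_card_finite[where 'a='n] by linarith
    ultimately show "generic_hilbert_fun TYPE('n) CARD('n) u = hfun CARD('n) u"
      unfolding generic_hilbert_fun_def h hilbert_fun_zero_ideal by (auto simp: hfun_def)
  qed
qed

end

text \<open>The pull-back of a frame along multiplication by \<open>g\<close>. The monomial
  \<open>1\<close> is set apart because the quotient is one-dimensional in degree zero, where the
  value \<open>1\<close> is itself a frame.\<close>

definition shift_frame :: "'v pol \<Rightarrow> ('v mon \<times> nat \<Rightarrow> complex) \<Rightarrow> 'v mon \<times> nat \<Rightarrow> complex" where
  "shift_frame g \<phi> = (\<lambda>(t, i). if t = 0 then 1 else frame_map \<phi> (single t 1 * g) i)"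

lemma frame_map_shift_frame:
  assumes "u \<noteq> 0" "f \<in> graded_piece u"
  shows "frame_map (shift_frame g \<phi>) f i = frame_map \<phi> (f * g) i"
proof -
  have "f * g = (\<Sum>t\<in>keys f. cscale (lookup f t) (single t 1 * g))"
    using pol_expand[of f] by (metis (no_types, lifting) cscale_mult_left single_eq_cscale sum.cong sum_distrib_right)
  then have "frame_map \<phi> (f * g) i = (\<Sum>t\<in>keys f. lookup f t * frame_map \<phi> (single t 1 * g) i)"
    by (simp add: frame_map_sum frame_map_cscale)
  also have "\<dots> = frame_map (shift_frame g \<phi>) f i"
    unfolding frame_map_def[of "shift_frame g \<phi>"]
    by (rule sum.cong) (use assms in \<open>auto simp: shift_frame_def graded_piece_def\<close>)
  finally show ?thesis by simp
qed

text \<open>For nonzero \<open>u\<close> the Hilbert function is \<open>r\<close> both at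
  \<open>u\<close> and at \<open>u + (r, r, r)\<close>, so multiplication by the nonzerodivisor
  \<open>g\<close> is an isomorphism between the quotients, and frames pull back to frames.\<close>

lemma shift_frame_in_frames:
  fixes J :: "'n::finite cvar pol set"
  assumes J: "homogeneous_ideal J" "1 \<notin> J" and h: "hilbert_fun J = hfun r"
    and g: "g \<in> graded_piece (r, r, r)" "nzd_mod J g"
    and \<phi>: "\<phi> \<in> frames (degs_ge r) (\<lambda>_. r) J" and r: "0 < r"
  shows "shift_frame g \<phi> \<in> frames UNIV (hfun r) J"
proof -
  note ij = homogeneous_is_ideal[OF J(1)]
  have "(\<forall>c. \<exists>f\<in>graded_piece u. \<forall>i<hfun r u. frame_map (shift_frame g \<phi>) f i = c i) \<and>
     (\<forall>f\<in>graded_piece u. f \<in> J \<longleftrightarrow> (\<forall>i<hfun r u. frame_map (shift_frame g \<phi>) f i = 0))" for u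
  proof (cases "u = 0")
    case True
    have fm: "frame_map (shift_frame g \<phi>) f i = lookup f 0" if "f \<in> graded_piece 0" for f i
    proof -
      have "frame_map (shift_frame g \<phi>) 1 i = 1" by (simp add: frame_map_def shift_frame_def)
      then show ?thesis using graded_0_expand[OF that] by (metis frame_map_cscale mult.right_neutral)
    qed
    have cs: "cscale c 1 \<in> graded_piece 0" for c
      by (rule poly.subspace_scale[OF subspace_graded_piece one_graded])
    have "f \<in> J \<longleftrightarrow> lookup f 0 = 0" if f: "f \<in> graded_piece 0" for f
    proof
      assume "f \<in> J"
      then have *: "cscale (lookup f 0) 1 \<in> J" using graded_0_expand[OF f] by simp
      show "lookup f 0 = 0"
      proof (rule ccontr)
        assume "lookup f 0 \<noteq> 0"
        then have "cscale (1 / lookup f 0) (cscale (lookup f 0) 1) = (1 :: 'n cvar pol)" by (simp add: poly.scale_scale)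
        then show False using ideal_cscale[OF ij *, of "1 / lookup f 0"] J(2) by simp
      qed
    next
      assume "lookup f 0 = 0"
      then show "f \<in> J" using graded_0_expand[OF f] ideal.subspace_0[OF ij] by simp
    qed
    moreover have "\<exists>f\<in>graded_piece 0. lookup f (0 :: 'n cvar mon) = c 0" for c :: "nat \<Rightarrow> complex"
      by (rule bexI[OF _ cs[of "c 0"]]) (simp add: lookup_cscale)
    ultimately show ?thesis using True fm by (simp add: hfun_def)
  next
    case False
    have D: "u + (r, r, r) \<in> degs_ge r" by (cases u) auto
    have "\<exists>f\<in>graded_piece u. \<forall>i<r. frame_map (shift_frame g \<phi>) f i = c i" for c
    proof -
      obtain f where f: "f \<in> graded_piece (u + (r, r, r))" "\<forall>i<r. frame_map \<phi> f i = c i"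
        using framesD(1)[OF \<phi> D] by blast
      have "u + (r, r, r) \<noteq> 0" using r by (cases u) (auto simp: zero_prod_def)
      then obtain s where s: "s \<in> graded_piece u" "f - s * g \<in> J"
        using hilbert_fun_nzd_surj[OF subspace_of_ideal[OF ij] g(2,1) _ f(1)] h False
        by (auto simp: hfun_def)
      have "f - s * g \<in> graded_piece (u + (r, r, r))"
        using f(1) s(1) g(1) by (intro poly.subspace_diff[OF subspace_graded_piece] mult_in_graded_piece)
      then have "\<forall>i<r. frame_map \<phi> (f - s * g) i = 0" using framesD(2)[OF \<phi> D] s(2) by blast
      then have "\<forall>i<r. frame_map (shift_frame g \<phi>) s i = c i"
        using f(2) frame_map_shift_frame[OF False s(1)] by (auto simp: frame_map_diff)
      with s(1) show ?thesis by blast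
    qed
    moreover have "f \<in> J \<longleftrightarrow> (\<forall>i<r. frame_map (shift_frame g \<phi>) f i = 0)" if f: "f \<in> graded_piece u" for f
    proof -
      have "f \<in> J \<longleftrightarrow> f * g \<in> J" using g(2) ideal_mult_right[OF ij, of f g] unfolding nzd_mod_def by blast
      also have "\<dots> \<longleftrightarrow> (\<forall>i<r. frame_map \<phi> (f * g) i = 0)"
        using framesD(2)[OF \<phi> D mult_in_graded_piece[OF f g(1)]] .
      finally show ?thesis using frame_map_shift_frame[OF False f] by simp
    qed
    ultimately show ?thesis using False by (simp add: hfun_def)
  qed
  then show ?thesis by (simp add: frames_def)
qed

text \<open>In frame coordinates, the matrix of multiplication by \<open>g\<close> from the linear
  forms of one axis to the quotient in degree \<open>udeg a + (m,m,m)\<close>, with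
  \<open>m = CARD('n)\<close>. It is square because both spaces have dimension
  \<open>m\<close>.\<close>

definition frame_matrix :: "'n::finite cvar pol \<Rightarrow> axis \<Rightarrow> ('n cvar mon \<times> nat \<Rightarrow> complex) \<Rightarrow> complex ^ 'n ^ 'n" where
  "frame_matrix g a \<phi> = (\<chi> i j. frame_map \<phi> (var (avar a j) * g) (idx i))"

lemma frame_matrix_mult:
  "(frame_matrix g a \<phi> *v c) $ i
    = frame_map \<phi> ((\<Sum>j\<in>UNIV. cscale (c $ j) (var (avar a j))) * g) (idx (i :: 'n::finite))"
  by (simp add: frame_matrix_def matrix_vector_mult_def sum_distrib_right cscale_mult_left
      frame_map_sum frame_map_cscale mult.commute[of _ "c $ _"])

lemma all_less_card_iff: "(\<forall>k<CARD('n). P k) \<longleftrightarrow> (\<forall>i :: 'n::finite. P (idx i))"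
proof
  assume *: "\<forall>i :: 'n. P (idx i)"
  show "\<forall>k<CARD('n). P k"
  proof (intro allI impI)
    fix k assume "k < CARD('n)"
    then obtain i :: 'n where "k = idx i" using bij_idx[where 'n='n] by (auto simp: bij_betw_def)
    with * show "P k" by simp
  qed
qed auto

context
  fixes J :: "'n::finite cvar pol set" and g :: "'n cvar pol" and \<phi>
  assumes J: "is_ideal J" and g: "g \<in> graded_piece (CARD('n), CARD('n), CARD('n))"
    and \<phi>: "\<phi> \<in> frames (degs_ge CARD('n)) (\<lambda>_. CARD('n)) J"
begin

lemma mem_iff_frame:
  "f \<in> graded_piece (udeg a + (CARD('n), CARD('n), CARD('n))) \<Longrightarrow> f \<in> J \<longleftrightarrow> (\<forall>i. frame_map \<phi> f (idx (i :: 'n)) = 0)"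
  using framesD(2)[OF \<phi>, of "udeg a + (CARD('n), CARD('n), CARD('n))"]
  by (cases a) (auto simp: all_less_card_iff)

text \<open>The kernel of the matrix consists of the linear forms \<open>s\<close> with
  \<open>s * g\<close> in \<open>J\<close>. It is trivial when \<open>g\<close> is a nonzerodivisor
  and \<open>J\<close> contains no nonzero linear form of this axis.\<close>

lemma det_frame_matrix_nz_iff:
  "det (frame_matrix g a \<phi>) \<noteq> 0 \<longleftrightarrow> (\<forall>s\<in>graded_piece (udeg a). s * g \<in> J \<longrightarrow> s = 0)"
proof -
  have *: "frame_matrix g a \<phi> *v c = 0 \<longleftrightarrow> (\<Sum>j\<in>UNIV. cscale (c $ j) (var (avar a j))) * g \<in> J" for c
    using mem_iff_frame[OF mult_in_graded_piece[OF sum_vars_graded g], of "\<lambda>j. c $ j" a]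
    by (simp add: vec_eq_iff frame_matrix_mult)
  have "det (frame_matrix g a \<phi>) \<noteq> 0 \<longleftrightarrow> (\<forall>c. frame_matrix g a \<phi> *v c = 0 \<longrightarrow> c = 0)"
    by (metis invertible_det_nz invertible_left_inverse matrix_left_invertible_ker)
  also have "\<dots> \<longleftrightarrow> (\<forall>s\<in>graded_piece (udeg a). s * g \<in> J \<longrightarrow> s = 0)"
    unfolding *
  proof (intro iffI ballI allI impI)
    fix s assume H: "\<forall>c. (\<Sum>j\<in>UNIV. cscale (c $ j) (var (avar a j))) * g \<in> J \<longrightarrow> c = 0"
      and s: "s \<in> graded_piece (udeg a)" "s * g \<in> J"
    define c :: "complex ^ 'n" where "c = (\<chi> i. lookup s (single (avar a i) 1))"
    have sc: "s = (\<Sum>j\<in>UNIV. cscale (c $ j) (var (avar a j)))"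
      using graded_udeg_expand[OF s(1)] by (simp add: c_def)
    then have "c = 0" using H s(2) by metis
    then show "s = 0" using sc by simp
  next
    fix c :: "complex ^ 'n" assume H: "\<forall>s\<in>graded_piece (udeg a). s * g \<in> J \<longrightarrow> s = 0"
      and c: "(\<Sum>j\<in>UNIV. cscale (c $ j) (var (avar a j))) * g \<in> J"
    then have "(\<Sum>j\<in>UNIV. cscale (c $ j) (var (avar a j))) = (0 :: 'n cvar pol)"
      using sum_vars_graded by blast
    then show "c = 0" by (simp add: sum_vars_eq_0_iff vec_eq_iff)
  qed
  finally show ?thesis .
qed

lemma det_frame_matrix_surj:
  assumes "det (frame_matrix g a \<phi>) \<noteq> 0" "f \<in> graded_piece (udeg a + (CARD('n), CARD('n), CARD('n)))"
  shows "\<exists>s\<in>graded_piece (udeg a). f - s * g \<in> J"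
proof -
  have "\<exists>B. frame_matrix g a \<phi> ** B = mat 1"
    using assms(1) by (metis invertible_det_nz invertible_right_inverse)
  then obtain c where c: "frame_matrix g a \<phi> *v c = (\<chi> i. frame_map \<phi> f (idx i))"
    unfolding matrix_right_invertible_surjective by (metis surjD)
  let ?s = "\<Sum>j\<in>UNIV. cscale (c $ j) (var (avar a j))"
  have "f - ?s * g \<in> graded_piece (udeg a + (CARD('n), CARD('n), CARD('n)))"
    using assms(2) g by (intro poly.subspace_diff[OF subspace_graded_piece] mult_in_graded_piece sum_vars_graded)
  moreover have "frame_map \<phi> (f - ?s * g) (idx i) = 0" for i :: 'n
    using frame_matrix_mult[of g a \<phi> c i] unfolding c by (simp add: frame_map_diff)
  ultimately have "f - ?s * g \<in> J" using mem_iff_frame by blast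
  then show ?thesis using sum_vars_graded by blast
qed

end

section \<open>Limits of ideals of points\<close>

definition mon_eval :: "'v mon \<Rightarrow> ('v \<Rightarrow> complex) \<Rightarrow> complex" where
  "mon_eval t x = (\<Prod>v\<in>keys t. x v ^ lookup t v)"

lemma mon_eval_superset:
  "finite A \<Longrightarrow> keys t \<subseteq> A \<Longrightarrow> mon_eval t x = (\<Prod>v\<in>A. x v ^ lookup t v)"
  unfolding mon_eval_def by (rule prod.mono_neutral_left) (auto simp: in_keys_iff)

lemma mon_eval_add: "mon_eval (s + t) x = mon_eval s x * mon_eval t x"
  using mon_eval_superset[of "keys s \<union> keys t" "s + t" x] Poly_Mapping.keys_add[of s t]
    mon_eval_superset[of "keys s \<union> keys t" s x] mon_eval_superset[of "keys s \<union> keys t" t x]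
  by (simp add: lookup_add power_add prod.distrib)

lemma mon_eval_single: "mon_eval (single v n) x = x v ^ n"
  by (cases "n = 0") (simp_all add: mon_eval_def)

text \<open>Evaluation is one coordinate of the linear map whose entries are the values of the
  monomials, so its additivity is inherited from \<open>frame_map\<close>.\<close>

lemma pol_eval_frame_map: "pol_eval p x = frame_map (\<lambda>(t, i). mon_eval t x) p 0"
  by (simp add: pol_eval_def frame_map_def mon_eval_def)

lemma pol_eval_add: "pol_eval (p + q) x = pol_eval p x + pol_eval q x"
  by (simp add: pol_eval_frame_map frame_map_add)

lemma pol_eval_diff: "pol_eval (p - q) x = pol_eval p x - pol_eval q x"
  by (simp add: pol_eval_frame_map frame_map_diff)

lemma pol_eval_0 [simp]: "pol_eval 0 x = 0"
  by (simp add: pol_eval_frame_map)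

lemma pol_eval_sum: "pol_eval (\<Sum>k\<in>K. f k) x = (\<Sum>k\<in>K. pol_eval (f k) x)"
  by (simp add: pol_eval_frame_map frame_map_sum)

lemma pol_eval_single: "pol_eval (single t c) x = c * mon_eval t x"
  by (cases "c = 0") (simp_all add: pol_eval_def mon_eval_def)

lemma pol_eval_mult: "pol_eval (p * q) x = pol_eval p x * pol_eval q x"
proof -
  have "p * q = (\<Sum>s\<in>keys p. \<Sum>t\<in>keys q. single s (lookup p s) * single t (lookup q t))"
    by (subst pol_expand[of p], subst pol_expand[of q]) (simp add: sum_product)
  then have "pol_eval (p * q) x
    = (\<Sum>s\<in>keys p. \<Sum>t\<in>keys q. (lookup p s * mon_eval s x) * (lookup q t * mon_eval t x))"
    by (simp add: pol_eval_sum mult_single pol_eval_single mon_eval_add mult_ac)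
  also have "\<dots> = pol_eval p x * pol_eval q x"
    by (simp add: pol_eval_def sum_product mon_eval_def)
  finally show ?thesis .
qed

text \<open>Zariski closures are tested by formal polynomials; this predicate lets determinants and
  composed maps act as tests without an explicit polynomial.\<close>

definition polyfun :: "(('v \<Rightarrow> complex) \<Rightarrow> complex) \<Rightarrow> bool" where
  "polyfun f \<longleftrightarrow> (\<exists>P. \<forall>x. f x = pol_eval P x)"

lemma polyfun_const: "polyfun (\<lambda>_. c)"
  unfolding polyfun_def by (rule exI[of _ "single 0 c"]) (simp add: pol_eval_single mon_eval_def)

lemma polyfun_coord: "polyfun (\<lambda>x. x v)"
  unfolding polyfun_def by (rule exI[of _ "var v"]) (simp add: var_def pol_eval_single mon_eval_single)

lemma polyfun_add: "polyfun f \<Longrightarrow> polyfun g \<Longrightarrow> polyfun (\<lambda>x. f x + g x)"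
  unfolding polyfun_def by (metis pol_eval_add)

lemma polyfun_mult: "polyfun f \<Longrightarrow> polyfun g \<Longrightarrow> polyfun (\<lambda>x. f x * g x)"
  unfolding polyfun_def by (metis pol_eval_mult)

lemma polyfun_sum: "(\<And>k. k \<in> K \<Longrightarrow> polyfun (f k)) \<Longrightarrow> polyfun (\<lambda>x. \<Sum>k\<in>K. f k x)"
  by (induction K rule: infinite_finite_induct) (auto intro: polyfun_const polyfun_add)

lemma polyfun_prod: "(\<And>k. k \<in> K \<Longrightarrow> polyfun (f k)) \<Longrightarrow> polyfun (\<lambda>x. \<Prod>k\<in>K. f k x)"
  by (induction K rule: infinite_finite_induct) (auto intro: polyfun_const polyfun_mult)

lemma polyfun_power: "polyfun f \<Longrightarrow> polyfun (\<lambda>x. f x ^ n)"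
  by (induction n) (auto intro: polyfun_const polyfun_mult)

lemma polyfun_compose:
  assumes "\<And>k. polyfun (\<lambda>x. \<Psi> x k)"
  shows "polyfun (\<lambda>x. pol_eval Q (\<Psi> x))"
  unfolding pol_eval_def
  by (intro polyfun_sum polyfun_mult polyfun_const polyfun_prod polyfun_power assms)

lemma polyfun_frame_map: "polyfun (\<lambda>\<phi>. frame_map \<phi> f i)"
  unfolding frame_map_def by (intro polyfun_sum polyfun_mult polyfun_const polyfun_coord)

lemma polyfun_shift_frame: "polyfun (\<lambda>\<phi>. shift_frame g \<phi> k)"
proof -
  obtain t i where "k = (t, i)" by (cases k) auto
  then show ?thesis
    by (cases "t = 0") (simp_all add: shift_frame_def polyfun_const polyfun_frame_map)
qed

lemma polyfun_det_frame_matrix: "polyfun (\<lambda>\<phi>. det (frame_matrix g a \<phi>))"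
  unfolding det_def frame_matrix_def
  by (simp, intro polyfun_sum polyfun_mult polyfun_const polyfun_prod polyfun_frame_map)

lemma zariski_closureD:
  assumes "x \<in> zariski_closure A" "polyfun f" "\<And>a. a \<in> A \<Longrightarrow> f a = 0"
  shows "f x = 0"
  using assms unfolding zariski_closure_def polyfun_def by auto

lemma homogeneous_vanishing_ideal: "homogeneous_ideal (vanishing_ideal P)"
proof -
  let ?J = "vanishing_ideal P"
  have hh: "hom_component v (hom_component u f) = (if v = u then hom_component u f else 0)"
    for u v and f :: "'a cvar pol"
    using hom_component_graded[OF hom_component_in, of v u f] by auto
  have add: "f + g \<in> ?J" if "f \<in> ?J" "g \<in> ?J" for f g
    using that by (simp add: vanishing_ideal_def hom_component_add pol_eval_add)
  \<comment> \<open>Homogeneity is built into the definition, but the ideal property is not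
    immediate. A single term merely shifts degrees, so each component of the product is a multiple
    of a component of \<open>f\<close>.\<close>
  have mono: "single t c * f \<in> ?J" if f: "f \<in> ?J" for t c f
  proof -
    have s: "single t c \<in> graded_piece (mon_deg t)" by (rule single_in_graded_piece) simp
    have "pol_eval (hom_component u (single t c * f)) p = 0" if "x \<in> P" "p \<in> x" for u x p
    proof -
      have "single t c * f = (\<Sum>w\<in>mon_deg ` keys f. single t c * hom_component w f)"
        using sum_hom_components[of f] by (metis sum_distrib_left)
      then have "pol_eval (hom_component u (single t c * f)) p
          = (\<Sum>w\<in>mon_deg ` keys f. pol_eval (hom_component u (single t c * hom_component w f)) p)"
        by (simp add: hom_component_sum pol_eval_sum)
      also have "\<dots> = 0"
      proof (rule sum.neutral, rule ballI)
        fix w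
        have "pol_eval (hom_component w f) p = 0"
          using f that unfolding vanishing_ideal_def by blast
        then show "pol_eval (hom_component u (single t c * hom_component w f)) p = 0"
          using hom_component_graded[OF mult_in_graded_piece[OF s hom_component_in], of u w f]
          by (simp add: pol_eval_mult)
      qed
      finally show ?thesis .
    qed
    then show ?thesis by (simp add: vanishing_ideal_def)
  qed
  have zero: "0 \<in> ?J" by (simp add: vanishing_ideal_def)
  have "h * f \<in> ?J" if f: "f \<in> ?J" for h f
  proof -
    have "(\<Sum>t\<in>A. single t (lookup h t) * f) \<in> ?J" if "finite A" for A
      using that by induction (auto intro: add mono f zero)
    from this[of "keys h"] have "(\<Sum>t\<in>keys h. single t (lookup h t)) * f \<in> ?J"
      by (simp add: sum_distrib_right)
    then show ?thesis using pol_expand[of h] by argo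
  qed
  then have "is_ideal ?J" using zero add by (intro is_idealI)
  then show ?thesis unfolding homogeneous_ideal_def
    by (auto simp: vanishing_ideal_def hh)
qed

lemma vanishing_ideal_graded:
  "f \<in> graded_piece u \<Longrightarrow> f \<in> vanishing_ideal P \<longleftrightarrow> (\<forall>x\<in>P. \<forall>p\<in>x. pol_eval f p = 0)"
proof -
  assume f: "f \<in> graded_piece u"
  have "(\<forall>v. pol_eval (hom_component v f) p = 0) \<longleftrightarrow> pol_eval f p = 0" for p
  proof
    assume "\<forall>v. pol_eval (hom_component v f) p = 0"
    then have "pol_eval (hom_component u f) p = 0" by blast
    then show "pol_eval f p = 0" by (simp add: hom_component_graded[OF f])
  qed (simp add: hom_component_graded[OF f])
  then show ?thesis unfolding vanishing_ideal_def by blast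
qed

lemma X_points_subset: "x \<in> X_points \<Longrightarrow> x \<subseteq> cox_points"
  by (auto simp: X_points_def quotient_def torus_rel_def)

lemma nzd_vanishing_ideal:
  assumes g: "g \<in> graded_piece v" and nz: "\<And>x p. x \<in> P \<Longrightarrow> p \<in> x \<Longrightarrow> pol_eval g p \<noteq> 0"
  shows "nzd_mod (vanishing_ideal P) g"
  unfolding nzd_mod_def
proof (intro allI impI)
  fix f assume fg: "f * g \<in> vanishing_ideal P"
  have "pol_eval (hom_component u f) p = 0" if "x \<in> P" "p \<in> x" for u x p
  proof -
    have "pol_eval (hom_component (u + v) (f * g)) p = 0"
      using fg that unfolding vanishing_ideal_def by blast
    then show ?thesis using nz[OF that] by (simp add: hom_component_mult[OF g] pol_eval_mult)
  qed
  then show "f \<in> vanishing_ideal P" by (simp add: vanishing_ideal_def)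
qed

text \<open>Its degree \<open>(r,r,r)\<close> moves every degree into \<open>degs_ge r\<close>, and
  its linear factors inherit the nonzerodivisor property from it.\<close>

definition multiplier :: "(axis \<Rightarrow> 'n::finite cvar pol) \<Rightarrow> nat \<Rightarrow> 'n cvar pol" where
  "multiplier l r = (l X1 * l X2 * l X3) ^ r"

lemma multiplier_graded:
  assumes "\<And>a. l a \<in> graded_piece (udeg a)"
  shows "multiplier l r \<in> graded_piece (r, r, r)"
proof (induction r)
  case 0
  then show ?case using one_graded by (simp add: multiplier_def zero_prod_def)
next
  case (Suc r)
  have "l X1 * l X2 * l X3 \<in> graded_piece (udeg X1 + udeg X2 + udeg X3)"
    by (intro mult_in_graded_piece assms)
  from mult_in_graded_piece[OF this Suc] show ?case by (simp add: multiplier_def)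
qed

lemma nzd_multiplier: "(\<And>a. nzd_mod J (l a)) \<Longrightarrow> nzd_mod J (multiplier l r)"
  unfolding multiplier_def by (intro nzd_mod_power nzd_mod_mult)

lemma nzd_of_multiplier:
  assumes "is_ideal J" "nzd_mod J (multiplier l r)" "r > 0"
  shows "nzd_mod J (l a)"
proof -
  have "l a dvd multiplier l r"
    unfolding multiplier_def by (rule dvd_trans[OF _ dvd_power]) (cases a; use assms(3) in simp)+
  then obtain h where h: "multiplier l r = l a * h" by blast
  show ?thesis unfolding nzd_mod_def
  proof (intro allI impI)
    fix f assume "f * l a \<in> J"
    then have "f * l a * h \<in> J" by (rule ideal_mult_right[OF assms(1)])
    then show "f \<in> J" using assms(2) unfolding nzd_mod_def h by (metis mult.assoc)
  qed
qed

section \<open>From smoothable schemes to Slip\<close>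

context
  fixes l :: "axis \<Rightarrow> 'n::finite cvar pol"
  assumes l: "\<And>a. l a \<in> graded_piece (udeg a)"
begin

abbreviation (input) "gm \<equiv> multiplier l CARD('n)"

text \<open>The determinants make multiplication by \<open>gm\<close> bijective from each space of
  linear forms. Surjectivity keeps the points off the zeros of \<open>gm\<close>, so
  \<open>gm\<close> and its linear factors are nonzerodivisors; injectivity excludes linear forms
  from the ideal. Together these fix the Hilbert function.\<close>

lemma distinct_points_generic:
  assumes P: "P \<subseteq> X_points" and \<phi>: "\<phi> \<in> frames (degs_ge CARD('n)) (\<lambda>_. CARD('n)) (vanishing_ideal P)"
    and det: "\<And>a. det (frame_matrix gm a \<phi>) \<noteq> 0"
  shows "hilbert_fun (vanishing_ideal P) = hfun CARD('n)"
    "shift_frame gm \<phi> \<in> frames UNIV (hfun CARD('n)) (vanishing_ideal P)"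
proof -
  let ?m = "CARD('n)" and ?J = "vanishing_ideal P"
  note hom = homogeneous_vanishing_ideal[of P]
  note ij = homogeneous_is_ideal[OF hom]
  note gg = multiplier_graded[OF l, of ?m]
  have nz: "pol_eval gm p \<noteq> 0" if x: "x \<in> P" "p \<in> x" for x p
  proof
    assume 0: "pol_eval gm p = 0"
    have "p \<in> cox_points" using X_points_subset P x by blast
    then obtain i j k where ijk: "p (Alpha i) \<noteq> 0" "p (Beta j) \<noteq> 0" "p (Gamma k) \<noteq> 0"
      by (auto simp: cox_points_def)
    \<comment> \<open>A monomial in variables that are nonzero at \<open>p\<close>, in a degree
      where every form is a multiple of \<open>gm\<close> modulo the ideal. A zero of
      \<open>gm\<close> at \<open>p\<close> would make it vanish there.\<close>
    define t where "t = single (Alpha i) (Suc ?m) + single (Beta j) ?m + single (Gamma k) ?m"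
    have "mon_deg t = udeg X1 + (?m, ?m, ?m)"
      by (simp add: t_def mon_deg_def lookup_add lookup_single when_def sum.distrib)
    then have t: "single t 1 \<in> graded_piece (udeg X1 + (?m, ?m, ?m))" by (rule single_in_graded_piece)
    obtain s where s: "s \<in> graded_piece (udeg X1)" "single t 1 - s * gm \<in> ?J"
      using det_frame_matrix_surj[OF ij gg \<phi> det t] by blast
    have "single t 1 - s * gm \<in> graded_piece (udeg X1 + (?m, ?m, ?m))"
      using t s(1) gg by (intro poly.subspace_diff[OF subspace_graded_piece] mult_in_graded_piece)
    then have "pol_eval (single t 1 - s * gm) p = 0" using s(2) x vanishing_ideal_graded by blast
    then have "pol_eval (single t 1) p = 0" using 0 by (simp add: pol_eval_diff pol_eval_mult)
    then show False using ijk by (simp add: pol_eval_single t_def mon_eval_add mon_eval_single)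
  qed
  have nzd: "nzd_mod ?J gm" by (rule nzd_vanishing_ideal[OF gg nz])
  have m: "0 < ?m" by simp
  have J1: "?J \<inter> graded_piece (udeg a) \<subseteq> {0}" for a
    using det_frame_matrix_nz_iff[OF ij gg \<phi>, of a] det[of a] ideal_mult_right[OF ij] by blast
  note nzl = nzd_of_multiplier[OF ij nzd m]
  note fr = hilbert_fun_frames[OF subspace_of_ideal[OF ij] \<phi>]
  show h: "hilbert_fun ?J = hfun ?m"
    by (rule hilbert_fun_of_bound(2)[OF hom l nzl J1 fr]) simp_all
  show "shift_frame gm \<phi> \<in> frames UNIV (hfun ?m) ?J"
    by (rule shift_frame_in_frames[OF hom one_notin[OF hom l nzl J1] h gg nzd \<phi> m])
qed

text \<open>Multiplication by \<open>gm\<close> turns frames in high degrees into frames in all degrees. It is a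
  polynomial map that applies to an ideal of distinct points as soon as the determinants do not
  vanish, so it carries the closure in high degrees into the closure in all degrees.\<close>

lemma smoothable_in_Slip:
  fixes J :: "'n cvar pol set"
  assumes J: "homogeneous_ideal J" and nzl: "\<And>a. nzd_mod J (l a)"
    and J1: "\<And>a. J \<inter> graded_piece (udeg a) \<subseteq> {0}"
    and sm: "J \<in> smoothable_subschemes CARD('n)"
  shows "J \<in> Slip CARD('n)"
proof -
  let ?m = "CARD('n)"
  note ij = homogeneous_is_ideal[OF J]
  note gg = multiplier_graded[OF l, of ?m]
  from sm obtain \<phi> where \<phi>: "\<phi> \<in> frames (degs_ge ?m) (\<lambda>_. ?m) J"
    "\<phi> \<in> zariski_closure (\<Union>J'\<in>ideals_of_distinct_points ?m. frames (degs_ge ?m) (\<lambda>_. ?m) J')"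
    unfolding smoothable_subschemes_def closure_in_def by blast
  note fr = hilbert_fun_frames[OF subspace_of_ideal[OF ij] \<phi>(1)]
  have h: "hilbert_fun J = hfun ?m" and gen: "generic_hilbert_fun TYPE('n) ?m = hfun ?m"
    by (rule hilbert_fun_of_bound[OF J l nzl J1 fr]; simp)+
  have nzd: "nzd_mod J gm" using nzl by (rule nzd_multiplier)
  have m: "0 < ?m" by simp
  have sf: "shift_frame gm \<phi> \<in> frames UNIV (hfun ?m) J"
    by (rule shift_frame_in_frames[OF J one_notin[OF J l nzl J1] h gg nzd \<phi>(1) m])
  have det: "det (frame_matrix gm a \<phi>) \<noteq> 0" for a
    using det_frame_matrix_nz_iff[OF ij gg \<phi>(1), of a] nzd J1[of a] unfolding nzd_mod_def by blast
  have "shift_frame gm \<phi> \<in> zariski_closure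
      (\<Union>J'\<in>ideals_of_distinct_points ?m \<inter> multigraded_hilb (hfun ?m). frames UNIV (hfun ?m) J')"
    unfolding zariski_closure_def
  proof (intro CollectI allI impI)
    fix Q :: "('n cvar mon \<times> nat) pol" assume Q: "\<forall>a\<in>\<Union>J'\<in>ideals_of_distinct_points ?m \<inter> multigraded_hilb (hfun ?m).
      frames UNIV (hfun ?m) J'. pol_eval Q a = 0"
    \<comment> \<open>The determinants enter as factors so that \<open>f\<close> also vanishes at
      frames to which \<open>distinct_points_generic\<close> does not apply. At the frame of
      \<open>J\<close> they are nonzero and can be cancelled.\<close>
    define f where "f \<phi> = pol_eval Q (shift_frame gm \<phi>) * det (frame_matrix gm X1 \<phi>)
      * det (frame_matrix gm X2 \<phi>) * det (frame_matrix gm X3 \<phi>)" for \<phi>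
    have pf: "polyfun f" unfolding f_def
      by (intro polyfun_mult polyfun_compose polyfun_shift_frame polyfun_det_frame_matrix)
    have f0: "f \<psi> = 0" if J': "J' \<in> ideals_of_distinct_points ?m" "\<psi> \<in> frames (degs_ge ?m) (\<lambda>_. ?m) J'" for \<psi> J'
    proof (cases "\<forall>a. det (frame_matrix gm a \<psi>) \<noteq> 0")
      case True
      obtain P where P: "P \<subseteq> X_points" "J' = vanishing_ideal P"
        using J'(1) by (auto simp: ideals_of_distinct_points_def)
      note dp = distinct_points_generic[OF P(1) that(2)[unfolded P(2)] True[rule_format], folded P(2)]
      have "J' \<in> multigraded_hilb (hfun ?m)"
        using homogeneous_vanishing_ideal[of P, folded P(2)] dp(1) by (simp add: multigraded_hilb_def)
      then have "pol_eval Q (shift_frame gm \<psi>) = 0" using Q that(1) dp(2) by blast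
      then show ?thesis by (simp add: f_def)
    next
      case False
      then obtain a where "det (frame_matrix gm a \<psi>) = 0" by blast
      then show ?thesis by (cases a) (simp_all add: f_def)
    qed
    have "f \<phi> = 0" by (rule zariski_closureD[OF \<phi>(2) pf]) (auto simp: f0)
    then show "pol_eval Q (shift_frame gm \<phi>) = 0" using det by (simp add: f_def)
  qed
  moreover have "J \<in> multigraded_hilb (hfun ?m)" using J h by (simp add: multigraded_hilb_def)
  ultimately show ?thesis using sf unfolding Slip_def Let_def gen closure_in_def by blast
qed

end

section \<open>The annihilator of a concise tensor\<close>

text \<open>\<open>F\<close> is linear in each group, so its exponents are at most one and the
  factorial quotients are \<open>1\<close>. Differentiation becomes contraction of coefficients,
  which has the shape of a \<open>frame_map\<close> and shares its linearity.\<close>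

lemma lookup_diff_act:
  fixes F :: "'n::finite cvar pol"
  assumes F: "F \<in> graded_piece (1, 1, 1)"
  shows "lookup (diff_act \<psi> F) t = frame_map (\<lambda>(a, i). lookup F (t + a)) \<psi> 0"
proof -
  let ?le = "\<lambda>a b. \<forall>v. lookup a v \<le> lookup b v"
  have *: "lookup (if ?le a b then single (b - a) (lookup \<psi> a * lookup F b *
            (\<Prod>v\<in>keys a. fact (lookup b v) / fact (lookup b v - lookup a v))) else 0) t
       = (if b = t + a then lookup \<psi> a * lookup F (t + a) else 0)"
    if b: "b \<in> keys F" for a b
  proof (cases "?le a b")
    case True
    have "lookup b v \<le> 1" for v
    proof -
      obtain c i where v: "v = avar c i" by (rule cvar_eq_avar)
      have "coord c (mon_deg b) = 1" using b F by (cases c) (auto simp: graded_piece_def)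
      then show ?thesis using lookup_le_coord_mon_deg[of b c i] v by simp
    qed
    then have "fact (lookup b v) / fact (lookup b v - lookup a v) = (1 :: complex)" for v
      by (metis (no_types, lifting) One_nat_def diff_le_self div_self fact_0 fact_Suc_0 fact_nonzero
          le_Suc_eq le_zero_eq le_trans)
    then have "(\<Prod>v\<in>keys a. fact (lookup b v) / fact (lookup b v - lookup a v)) = (1 :: complex)"
      by simp
    moreover have "b - a = t \<longleftrightarrow> b = t + a"
    proof
      assume "b - a = t"
      then show "b = t + a"
        using True by (intro poly_mapping_eqI) (auto simp: lookup_add lookup_minus)
    qed simp
    ultimately show ?thesis using True by (auto simp: lookup_single when_def)
  next
    case False
    then have "b \<noteq> t + a" by (auto simp: lookup_add)
    then show ?thesis unfolding if_not_P[OF False] by simp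
  qed
  have "lookup (diff_act \<psi> F) t
    = (\<Sum>a\<in>keys \<psi>. \<Sum>b\<in>keys F. if b = t + a then lookup \<psi> a * lookup F (t + a) else 0)"
    unfolding diff_act_def lookup_sum by (intro sum.cong refl *)
  also have "\<dots> = (\<Sum>a\<in>keys \<psi>. lookup \<psi> a * lookup F (t + a))"
    by (intro sum.cong refl) (auto simp: sum.delta in_keys_iff)
  finally show ?thesis by (simp add: frame_map_def)
qed

lemma Ann_iff:
  assumes "F \<in> graded_piece (1, 1, 1)"
  shows "\<psi> \<in> Ann F \<longleftrightarrow> (\<forall>t. frame_map (\<lambda>(a, i). lookup F (t + a)) \<psi> 0 = 0)"
  unfolding Ann_def lookup_diff_act[OF assms, symmetric] by (auto intro: poly_mapping_eqI)

lemma subspace_Ann: "F \<in> graded_piece (1, 1, 1) \<Longrightarrow> poly.subspace (Ann F)"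
  by (rule poly.subspaceI) (simp_all add: Ann_iff frame_map_add frame_map_cscale)

lemma frame_map_single: "frame_map \<phi> (single t c) i = c * \<phi> (t, i)"
  by (cases "c = 0") (simp_all add: frame_map_def)

lemma frame_map_var: "frame_map \<phi> (var v) i = \<phi> (single v 1, i)"
  by (simp add: var_def frame_map_single)

lemma var_mult_var: "var v * var w = single (single v 1 + single w 1) 1"
  by (simp add: var_def mult_single)

lemma concise_axis: "concise F \<Longrightarrow> Ann F \<inter> graded_piece (udeg c) = {0}"
  by (cases c) (simp_all add: concise_def)

text \<open>The complex conjugates of the coefficients of \<open>F\<close> provide \<open>m\<close> elements of degree
  \<open>udeg a + udeg b\<close>; their images under \<open>F\<close> form the Gram matrix of the slices of \<open>F\<close>, which is
  positive definite as the slices are linearly independent.\<close>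

lemma card_le_hilbert_fun_Ann:
  fixes F :: "'n::finite cvar pol"
  assumes F: "F \<in> graded_piece (1, 1, 1)" and conc: "concise F" and ab: "a \<noteq> b"
  shows "CARD('n) \<le> hilbert_fun (Ann F) (udeg a + udeg b)"
proof -
  obtain c where c: "udeg a + udeg b + udeg c = (1, 1, 1)"
  proof -
    have "\<exists>c. udeg a + udeg b + udeg c = (1, 1, 1)"
      by (cases a; cases b) (use ab in \<open>auto intro: exI[of _ X1] exI[of _ X2] exI[of _ X3]\<close>)
    then show thesis using that by blast
  qed
  define T where "T i j k = lookup F (single (avar c k) 1 + (single (avar a i) 1 + single (avar b j) 1))" for i j k
  define e where "e l = (\<Sum>i\<in>UNIV. \<Sum>j\<in>UNIV. cscale (cnj (T i j l)) (var (avar a i) * var (avar b j)))" for l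
  have e_graded: "e ` UNIV \<subseteq> graded_piece (udeg a + udeg b)"
    unfolding e_def
    by (auto intro!: poly.subspace_sum poly.subspace_scale subspace_graded_piece mult_in_graded_piece var_graded)
  have "indep_mod (Ann F) UNIV e"
    unfolding indep_mod_def
  proof (intro allI impI)
    fix d :: "'n \<Rightarrow> complex"
    assume "(\<Sum>l\<in>UNIV. cscale (d l) (e l)) \<in> Ann F"
    then have "frame_map (\<lambda>(a, i). lookup F (single (avar c k) 1 + a)) (\<Sum>l\<in>UNIV. cscale (d l) (e l)) 0 = 0" for k
      using Ann_iff[OF F] by blast
    then have G: "(\<Sum>l\<in>UNIV. d l * (\<Sum>i\<in>UNIV. \<Sum>j\<in>UNIV. cnj (T i j l) * T i j k)) = 0" for k
      by (simp add: e_def frame_map_sum frame_map_cscale var_mult_var frame_map_single T_def)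
    \<comment> \<open>The combination of slices with coefficients \<open>cnj (d k)\<close>. Its
      squared norm is the Gram form at \<open>d\<close>, which vanishes by \<open>G\<close>.\<close>
    define w where "w i j = (\<Sum>k\<in>UNIV. cnj (d k) * T i j k)" for i j
    have ww: "w i j * cnj (w i j)
      = (\<Sum>k\<in>UNIV. \<Sum>l\<in>UNIV. cnj (d k) * (d l * (cnj (T i j l) * T i j k)))" for i j
    proof -
      have "cnj (w i j) = (\<Sum>l\<in>UNIV. d l * cnj (T i j l))" by (simp add: w_def)
      then have "w i j * cnj (w i j) = (\<Sum>k\<in>UNIV. \<Sum>l\<in>UNIV. (cnj (d k) * T i j k) * (d l * cnj (T i j l)))"
        by (simp only: w_def[of i j] sum_product)
      also have "\<dots> = (\<Sum>k\<in>UNIV. \<Sum>l\<in>UNIV. cnj (d k) * (d l * (cnj (T i j l) * T i j k)))"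
        by (intro sum.cong refl) (simp add: mult_ac)
      finally show ?thesis .
    qed
    have "(\<Sum>i\<in>UNIV. \<Sum>j\<in>UNIV. w i j * cnj (w i j))
      = (\<Sum>i\<in>UNIV. \<Sum>j\<in>UNIV. \<Sum>k\<in>UNIV. \<Sum>l\<in>UNIV. cnj (d k) * (d l * (cnj (T i j l) * T i j k)))"
      by (simp only: ww)
    also have "\<dots> = (\<Sum>i\<in>UNIV. \<Sum>k\<in>UNIV. \<Sum>l\<in>UNIV. \<Sum>j\<in>UNIV. cnj (d k) * (d l * (cnj (T i j l) * T i j k)))"
      by (rule sum.cong[OF refl], subst sum.swap, rule sum.cong[OF refl], rule sum.swap)
    also have "\<dots> = (\<Sum>k\<in>UNIV. \<Sum>l\<in>UNIV. \<Sum>i\<in>UNIV. \<Sum>j\<in>UNIV. cnj (d k) * (d l * (cnj (T i j l) * T i j k)))"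
      by (subst sum.swap, rule sum.cong[OF refl], rule sum.swap)
    also have "\<dots> = (\<Sum>k\<in>UNIV. cnj (d k) * (\<Sum>l\<in>UNIV. d l * (\<Sum>i\<in>UNIV. \<Sum>j\<in>UNIV. cnj (T i j l) * T i j k)))"
      by (simp add: sum_distrib_left)
    also have "\<dots> = 0" by (simp add: G)
    finally have "complex_of_real (\<Sum>i\<in>UNIV. \<Sum>j\<in>UNIV. (cmod (w i j))\<^sup>2) = 0"
      by (simp only: of_real_sum complex_norm_square)
    then have "(\<Sum>i\<in>UNIV. \<Sum>j\<in>UNIV. (cmod (w i j))\<^sup>2) = 0"
      by (simp only: of_real_eq_0_iff)
    then have w0: "w i j = 0" for i j
      by (simp add: sum_nonneg_eq_0_iff sum_nonneg)
    \<comment> \<open>Vanishing of \<open>w\<close> says that this linear form annihilates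
      \<open>F\<close>; coefficients outside degree \<open>udeg a + udeg b\<close> are zero for
      degree reasons.\<close>
    let ?\<theta> = "\<Sum>k\<in>UNIV. cscale (cnj (d k)) (var (avar c k))"
    have "frame_map (\<lambda>(a, i). lookup F (t + a)) ?\<theta> 0 = 0" for t
    proof (cases "mon_deg t = udeg a + udeg b")
      case True
      then have "coord a (mon_deg t) > 0" by (simp add: coord_udeg)
      then obtain i s where s: "t = single (avar a i) 1 + s" using mon_factor by blast
      then have "mon_deg s = udeg b" using True mon_deg_avar[of a i] by (simp add: mon_deg_add)
      then obtain j where "s = single (avar b j) 1" using mon_deg_eq_udegD by blast
      then have "frame_map (\<lambda>(a, i). lookup F (t + a)) ?\<theta> 0 = w i j"
        using s by (simp add: frame_map_sum frame_map_cscale frame_map_var w_def T_def add.commute)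
      then show ?thesis by (simp add: w0)
    next
      case False
      have "lookup F (t + single (avar c k) 1) = 0" for k
      proof (rule ccontr)
        assume "lookup F (t + single (avar c k) 1) \<noteq> 0"
        then have "mon_deg (t + single (avar c k) 1) = udeg a + udeg b + udeg c"
          using F unfolding c graded_piece_iff by blast
        then show False using False unfolding mon_deg_add mon_deg_avar by simp
      qed
      then show ?thesis by (simp add: frame_map_sum frame_map_cscale frame_map_var)
    qed
    then have "?\<theta> \<in> Ann F \<inter> graded_piece (udeg c)" by (simp add: Ann_iff[OF F] sum_vars_graded)
    then have "?\<theta> = 0" using concise_axis[OF conc] by blast
    then show "\<forall>l\<in>UNIV. d l = 0" unfolding sum_vars_eq_0_iff by simp
  qed
  then show ?thesis using card_le_hilbert_fun[OF subspace_Ann[OF F] _ e_graded] by simp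
qed

lemma graded_Ann_eq:
  fixes F :: "'n::finite cvar pol"
  assumes "F \<in> graded_piece (1, 1, 1)" "concise F" "a \<noteq> b"
    and "is_ideal J" "J \<subseteq> Ann F" "hilbert_fun J (udeg a + udeg b) = CARD('n)"
  shows "J \<inter> graded_piece (udeg a + udeg b) = Ann F \<inter> graded_piece (udeg a + udeg b)"
  using assms card_le_hilbert_fun_Ann[OF assms(1-3)]
  by (intro hilbert_fun_eqD subspace_of_ideal subspace_Ann) auto

section \<open>The coordinate points of X\<close>

definition axis_mon :: "'n \<Rightarrow> 'n \<Rightarrow> 'n \<Rightarrow> tridegree \<Rightarrow> 'n cvar mon" where
  "axis_mon i j k u = single (Alpha i) (fst u) + single (Beta j) (fst (snd u)) + single (Gamma k) (snd (snd u))"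

lemma mon_deg_axis_mon [simp]: "mon_deg (axis_mon i j k u) = u"
  by (cases u) (simp add: axis_mon_def mon_deg_def lookup_add lookup_single when_def sum.distrib)

lemma sum_eq_at:
  assumes "\<And>i. f i \<noteq> 0 \<Longrightarrow> i = j"
  shows "(\<Sum>i\<in>(UNIV :: 'n::finite set). f i :: nat) = f j"
proof -
  have "(\<Sum>i\<in>UNIV. f i) = (\<Sum>i\<in>UNIV. if i = j then f i else 0)"
    using assms by (intro sum.cong) auto
  then show ?thesis by simp
qed

lemma eq_axis_mon:
  assumes "\<And>v. lookup t v \<noteq> 0 \<Longrightarrow> v \<in> {Alpha i, Beta j, Gamma k}"
  shows "t = axis_mon i j k (mon_deg t)"
proof (rule poly_mapping_eqI)
  fix v
  have "(\<Sum>i'\<in>UNIV. lookup t (Alpha i')) = lookup t (Alpha i)"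
    "(\<Sum>i'\<in>UNIV. lookup t (Beta i')) = lookup t (Beta j)"
    "(\<Sum>i'\<in>UNIV. lookup t (Gamma i')) = lookup t (Gamma k)"
    using sum_eq_at[where j=i and f="\<lambda>i. lookup t (Alpha i)"] sum_eq_at[where j=j and f="\<lambda>i. lookup t (Beta i)"]
      sum_eq_at[where j=k and f="\<lambda>i. lookup t (Gamma i)"] assms by blast+
  then show "lookup t v = lookup (axis_mon i j k (mon_deg t)) v"
    using assms[of v] by (cases v) (auto simp: axis_mon_def mon_deg_def lookup_add lookup_single when_def)
qed

definition coord_point :: "'n \<times> 'n \<times> 'n \<Rightarrow> 'n cvar \<Rightarrow> complex" where
  "coord_point q v = (case q of (i, j, k) \<Rightarrow> if v \<in> {Alpha i, Beta j, Gamma k} then 1 else 0)"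

definition coord_points :: "('n::finite cvar \<Rightarrow> complex) set set" where
  "coord_points = range (\<lambda>q. torus_rel `` {coord_point q})"

lemma coord_point_in: "coord_point q \<in> cox_points"
  by (cases q) (auto simp: cox_points_def coord_point_def)

lemma torus_rel_refl: "p \<in> cox_points \<Longrightarrow> (p, p) \<in> torus_rel"
  unfolding torus_rel_def by (auto intro!: exI[of _ 1])

lemma coord_orbit:
  assumes "p \<in> torus_rel `` {coord_point (i, j, k)}"
  shows "p v \<noteq> 0 \<longleftrightarrow> v \<in> {Alpha i, Beta j, Gamma k}"
  using assms by (cases v) (auto simp: torus_rel_def coord_point_def split: if_split_asm)

text \<open>The torus preserves supports, and the support of a coordinate point determines its
  triple of indices.\<close>

lemma inj_coord_orbit: "inj (\<lambda>q. torus_rel `` {coord_point q})"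
proof (rule injI)
  fix q q' :: "'n \<times> 'n \<times> 'n"
  assume eq: "torus_rel `` {coord_point q} = torus_rel `` {coord_point q'}"
  obtain i j k i' j' k' where q: "q = (i, j, k)" "q' = (i', j', k')" by (cases q; cases q') auto
  have "coord_point q \<in> torus_rel `` {coord_point q'}"
    using torus_rel_refl[OF coord_point_in[of q]] eq by blast
  then have "v \<in> {Alpha i, Beta j, Gamma k} \<longleftrightarrow> v \<in> {Alpha i', Beta j', Gamma k'}" for v
    using coord_orbit[of "coord_point q" i' j' k' v] unfolding q
    by (auto simp: coord_point_def simp del: Image_singleton_iff split: if_split_asm)
  then show "q = q'" unfolding q by (metis cvar.distinct cvar.inject insert_iff singletonD)
qed

text \<open>Only one monomial of each degree survives at a point supported on three variables. A
  hypothesis on the support alone makes this apply to the whole torus orbit.\<close>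

lemma pol_eval_coord:
  assumes f: "f \<in> graded_piece u" and p: "\<And>v. p v \<noteq> 0 \<longleftrightarrow> v \<in> {Alpha i, Beta j, Gamma k}"
  shows "pol_eval f p = 0 \<longleftrightarrow> lookup f (axis_mon i j k u) = 0"
proof -
  have "mon_eval t p = 0" if t: "t \<in> keys f" "t \<noteq> axis_mon i j k u" for t
  proof -
    have "mon_deg t = u" using f t(1) by (auto simp: graded_piece_def)
    then obtain v where "lookup t v \<noteq> 0" "p v = 0" using eq_axis_mon[of t i j k] t(2) p by blast
    then show ?thesis unfolding mon_eval_def by (auto simp: in_keys_iff)
  qed
  then have "pol_eval f p = (\<Sum>t\<in>keys f. if t = axis_mon i j k u then lookup f t * mon_eval t p else 0)"
    unfolding pol_eval_def mon_eval_def[symmetric] by (intro sum.cong) auto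
  also have "\<dots> = lookup f (axis_mon i j k u) * mon_eval (axis_mon i j k u) p"
    by (simp add: sum.delta in_keys_iff)
  finally show ?thesis using p[of "Alpha i"] p[of "Beta j"] p[of "Gamma k"]
    by (simp add: axis_mon_def mon_eval_add mon_eval_single)
qed

lemma coord_points_vanishing_iff:
  "f \<in> vanishing_ideal (coord_points)
    \<longleftrightarrow> (\<forall>u i j k. lookup f (axis_mon i j k u :: 'n::finite cvar mon) = 0)"
proof
  assume f: "f \<in> vanishing_ideal (coord_points)"
  show "\<forall>u i j k. lookup f (axis_mon i j k u :: 'n cvar mon) = 0"
  proof (intro allI)
    fix u and i j k :: 'n
    have "coord_point (i, j, k) \<in> torus_rel `` {coord_point (i, j, k)}"
      using torus_rel_refl[OF coord_point_in] by blast
    then have "pol_eval (hom_component u f) (coord_point (i, j, k)) = 0"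
      using f unfolding vanishing_ideal_def coord_points_def by blast
    then have "lookup (hom_component u f) (axis_mon i j k u) = 0"
      using pol_eval_coord[OF hom_component_in, of "coord_point (i, j, k)" i j k u f]
      by (simp add: coord_point_def)
    then show "lookup f (axis_mon i j k u) = 0" by (simp add: lookup_hom_component)
  qed
next
  assume *: "\<forall>u i j k. lookup f (axis_mon i j k u :: 'n cvar mon) = 0"
  have "pol_eval (hom_component u f) p = 0" if "p \<in> torus_rel `` {coord_point q}" for u p q
  proof -
    obtain i j k where q: "q = (i, j, k)" by (cases q) auto
    show ?thesis using pol_eval_coord[OF hom_component_in[of u f] coord_orbit[of p i j k]] that * q
      by (simp add: lookup_hom_component)
  qed
  then show "f \<in> vanishing_ideal (coord_points)"
    unfolding vanishing_ideal_def coord_points_def by blast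
qed

lemma var3_graded: "var (Alpha i) * var (Beta j) * var (Gamma k) \<in> graded_piece (1, 1, 1)"
  using mult_in_graded_piece[OF mult_in_graded_piece[OF var_graded[of X1 i] var_graded[of X2 j]]
      var_graded[of X3 k]] by simp

lemma B_saturated_vanishing_ideal:
  assumes "P \<subseteq> X_points"
  shows "B_saturated (vanishing_ideal P)"
  unfolding B_saturated_def
proof (intro equalityI subsetI)
  fix f assume "f \<in> vanishing_ideal P"
  then have "\<forall>b\<in>ideal_power irrelevant_ideal 0. f * b \<in> vanishing_ideal P"
    using ideal_mult_right[OF homogeneous_is_ideal[OF homogeneous_vanishing_ideal]] by blast
  then show "f \<in> saturation (vanishing_ideal P) irrelevant_ideal" unfolding saturation_def by blast
next
  fix f assume "f \<in> saturation (vanishing_ideal P) irrelevant_ideal"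
  then obtain n where n: "\<And>b. b \<in> ideal_power irrelevant_ideal n \<Longrightarrow> f * b \<in> vanishing_ideal P"
    unfolding saturation_def by blast
  have "pol_eval (hom_component u f) p = 0" if x: "x \<in> P" "p \<in> x" for u x p
  proof -
    have "p \<in> cox_points" using X_points_subset assms x by blast
    then obtain i j k where ijk: "p (Alpha i) \<noteq> 0" "p (Beta j) \<noteq> 0" "p (Gamma k) \<noteq> 0"
      by (auto simp: cox_points_def)
    \<comment> \<open>A generator of the irrelevant ideal that is nonzero at \<open>p\<close>; its
      powers lie in the powers of that ideal and can be divided out of the values at
      \<open>p\<close>.\<close>
    define b where "b = var (Alpha i) * var (Beta j) * var (Gamma k)"
    have bB: "b \<in> irrelevant_ideal"
      unfolding irrelevant_ideal_def b_def by (rule ideal.span_base) blast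
    have "b ^ N \<in> ideal_power irrelevant_ideal N \<and> b ^ N \<in> graded_piece (N, N, N) \<and> pol_eval (b ^ N) p \<noteq> 0" for N
    proof (induction N)
      case 0
      then show ?case using one_graded by (simp add: zero_prod_def pol_eval_def)
    next
      case (Suc N)
      have "b \<in> graded_piece (1, 1, 1)" unfolding b_def by (rule var3_graded)
      moreover have "b ^ Suc N \<in> ideal_power irrelevant_ideal (Suc N)"
        using bB Suc by (auto intro!: ideal.span_base)
      moreover have "pol_eval b p \<noteq> 0"
        using ijk by (simp add: b_def pol_eval_mult var_def pol_eval_single mon_eval_single)
      ultimately show ?case using Suc mult_in_graded_piece[of b "(1, 1, 1)" "b ^ N" "(N, N, N)"]
        by (simp add: pol_eval_mult)
    qed
    then have bn: "f * b ^ n \<in> vanishing_ideal P" "b ^ n \<in> graded_piece (n, n, n)" "pol_eval (b ^ n) p \<noteq> 0"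
      using n by blast+
    have "pol_eval (hom_component (u + (n, n, n)) (f * b ^ n)) p = 0"
      using bn(1) x unfolding vanishing_ideal_def by blast
    then show ?thesis using bn(3) by (simp add: hom_component_mult[OF bn(2)] pol_eval_mult)
  qed
  then show "f \<in> vanishing_ideal P" by (simp add: vanishing_ideal_def)
qed

text \<open>This makes the \<open>LEAST\<close> in \<open>smoothable_rank\<close> an attained value.
  Every monomial of degree \<open>(1,1,1)\<close> is the Segre image of a coordinate point, so the
  ideal of all coordinate points annihilates every tensor.\<close>

lemma exists_smoothable:
  fixes F :: "'n::finite cvar pol"
  assumes F: "F \<in> graded_piece (1, 1, 1)"
  shows "\<exists>r. \<exists>J\<in>smoothable_subschemes r. J \<subseteq> Ann F"
proof -
  define P where "P = (coord_points :: ('n cvar \<Rightarrow> complex) set set)"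
  define J where "J = vanishing_ideal P"
  define r where "r = CARD('n \<times> 'n \<times> 'n)"
  have P: "P \<subseteq> X_points" "finite P" "card P = r"
  proof -
    show "P \<subseteq> X_points"
      unfolding P_def coord_points_def X_points_def by (intro image_subsetI quotientI coord_point_in)
    show "finite P" "card P = r"
      unfolding P_def coord_points_def r_def card_image[OF inj_coord_orbit] by simp_all
  qed
  note hom = homogeneous_vanishing_ideal[of P, folded J_def]
  note ij = homogeneous_is_ideal[OF hom]
  have r: "r \<ge> 1" unfolding r_def by (simp add: Suc_leI)
  define mon where "mon q u = (case q of (i, j, k) \<Rightarrow> axis_mon i j k u)" for q :: "'n \<times> 'n \<times> 'n" and u
  \<comment> \<open>Coordinate \<open>n\<close> belongs to the point numbered \<open>n\<close> and
    reads off the coefficient of its axis monomial, in every degree at once.\<close>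
  define \<phi> :: "'n cvar mon \<times> nat \<Rightarrow> complex" where
    "\<phi> = (\<lambda>(t, n). if t = mon (the_inv_into UNIV idx n) (mon_deg t) then 1 else 0)"
  have fm: "frame_map \<phi> f (idx q) = lookup f (mon q u)" if f: "f \<in> graded_piece u" for f q u
  proof -
    have "frame_map \<phi> f (idx q) = (\<Sum>t\<in>keys f. if t = mon q u then lookup f t else 0)"
      unfolding frame_map_def
      by (rule sum.cong) (use f in \<open>auto simp: \<phi>_def graded_piece_def\<close>)
    then show ?thesis by (simp add: sum.delta in_keys_iff)
  qed
  have J_iff: "f \<in> J \<longleftrightarrow> (\<forall>n<r. frame_map \<phi> f n = 0)" if f: "f \<in> graded_piece u" for f u
  proof -
    have "f \<in> J \<longleftrightarrow> (\<forall>q. lookup f (mon q u) = 0)"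
    proof -
      have "lookup f (axis_mon i j k v) = 0" if "v \<noteq> u" for i j k v
        using f that unfolding graded_piece_iff by (metis mon_deg_axis_mon)
      then have "f \<in> J \<longleftrightarrow> (\<forall>i j k. lookup f (axis_mon i j k u) = 0)"
        unfolding J_def P_def coord_points_vanishing_iff by metis
      then show ?thesis by (simp add: mon_def)
    qed
    then show ?thesis unfolding r_def all_less_card_iff fm[OF f] .
  qed
  have "\<phi> \<in> frames (degs_ge r) (\<lambda>_. r) J"
    unfolding frames_def
  proof (intro CollectI ballI conjI allI)
    fix u and c :: "nat \<Rightarrow> complex" assume u: "u \<in> degs_ge r"
    define f where "f = (\<Sum>q\<in>UNIV. single (mon q u) (c (idx q)))"
    have "mon q u = mon q' u \<longleftrightarrow> q = q'" for q q'
    proof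
      assume eq: "mon q u = mon q' u"
      obtain i j k i' j' k' where q: "q = (i, j, k)" "q' = (i', j', k')" by (cases q; cases q') auto
      have "lookup (axis_mon i j k u) v = lookup (axis_mon i' j' k' u) v" for v
        using eq by (simp add: mon_def q)
      \<comment> \<open>All entries of \<open>u\<close> are positive here, so all three indices are
        visible; in a degree with a zero entry, distinct points can share an axis monomial.\<close>
      from this[of "Alpha i"] this[of "Beta j"] this[of "Gamma k"] show "q = q'"
        using u r by (auto simp: q axis_mon_def lookup_add lookup_single when_def split: if_splits)
    qed simp
    then have lf: "lookup f (mon q u) = c (idx q)" for q
      by (simp add: f_def lookup_sum lookup_single when_def sum.delta')
    have md: "mon_deg (mon q u) = u" for q by (simp add: mon_def split: prod.split)
    have fg: "f \<in> graded_piece u" unfolding f_def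
      by (intro poly.subspace_sum subspace_graded_piece single_in_graded_piece md)
    then have "\<forall>n<r. frame_map \<phi> f n = c n"
      unfolding r_def all_less_card_iff using fm[OF fg] lf by simp
    with fg show "\<exists>f\<in>graded_piece u. \<forall>i<r. frame_map \<phi> f i = c i" by blast
  qed (rule J_iff)
  note \<phi> = this
  have hf: "hilbert_fun J u = r" if "u \<in> degs_ge r" for u
    by (rule hilbert_fun_frames[OF subspace_of_ideal[OF ij] \<phi> that])
  have "J \<in> finite_subschemes r"
    unfolding finite_subschemes_def
    using hom B_saturated_vanishing_ideal[OF P(1)] hf by (auto simp: J_def intro!: exI[of _ r])
  moreover have "J \<in> ideals_of_distinct_points r"
    using P unfolding ideals_of_distinct_points_def J_def by blast
  ultimately have "J \<in> smoothable_subschemes r"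
    using \<phi> unfolding smoothable_subschemes_def closure_in_def zariski_closure_def by blast
  moreover have "J \<subseteq> Ann F"
  proof
    fix f assume "f \<in> J"
    then have f: "lookup f (axis_mon i j k u) = 0" for i j k u
      unfolding J_def P_def coord_points_vanishing_iff by blast
    \<comment> \<open>A monomial of \<open>F\<close> has one variable from each group, so any
      divisor \<open>a\<close> of it is an axis monomial, where \<open>f\<close> has coefficient
      zero.\<close>
    have "lookup f a * lookup F (t + a) = 0" for t a
    proof (rule ccontr)
      assume nz: "lookup f a * lookup F (t + a) \<noteq> 0"
      then have d: "mon_deg (t + a) = udeg X1 + (udeg X2 + udeg X3)" using F by (simp add: graded_piece_iff)
      then have "coord X1 (mon_deg (t + a)) > 0" by simp
      then obtain i s where s: "t + a = single (avar X1 i) 1 + s" using mon_factor by blast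
      then have ds: "mon_deg s = udeg X2 + udeg X3"
        using d unfolding s mon_deg_add mon_deg_avar by (metis add_left_cancel)
      then have "coord X2 (mon_deg s) > 0" by simp
      then obtain j s' where s': "s = single (avar X2 j) 1 + s'" using mon_factor by blast
      then have "mon_deg s' = udeg X3"
        using ds unfolding s' mon_deg_add mon_deg_avar by (metis add_left_cancel)
      then obtain k where "s' = single (avar X3 k) 1" using mon_deg_eq_udegD by blast
      then have "t + a = single (Alpha i) 1 + (single (Beta j) 1 + single (Gamma k) 1)"
        using s s' by simp
      then have tav: "lookup t v + lookup a v = lookup (single (Alpha i) 1 + (single (Beta j) 1 + single (Gamma k) 1)) v" for v
        by (metis lookup_add)
      have "v \<in> {Alpha i, Beta j, Gamma k}" if "lookup a v \<noteq> 0" for v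
        using tav[of v] that by (auto simp: lookup_add lookup_single when_def split: if_splits)
      then have "a = axis_mon i j k (mon_deg a)" by (rule eq_axis_mon)
      then have "lookup f a = 0" using f by metis
      with nz show False by simp
    qed
    then show "f \<in> Ann F" unfolding Ann_iff[OF F] frame_map_def by (auto intro!: sum.neutral)
  qed
  ultimately show ?thesis by blast
qed

section \<open>Uniqueness\<close>

context
  fixes J I :: "'n::finite cvar pol set" and l :: "axis \<Rightarrow> 'n cvar pol"
  assumes J: "homogeneous_ideal J" and I: "is_ideal I" "I \<subseteq> J"
    and l: "\<And>a. l a \<in> graded_piece (udeg a)" "\<And>a. nzd_mod J (l a)"
    and h: "hilbert_fun J = hfun CARD('n)"
    and JI: "\<And>a b. a \<noteq> b \<Longrightarrow> J \<inter> graded_piece (udeg a + udeg b) \<subseteq> I"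
begin

text \<open>The Hilbert function agrees at \<open>udeg y\<close> and \<open>udeg y + udeg x\<close>,
  so a product of two variables is a multiple of \<open>l x\<close> modulo \<open>J\<close>. The
  correction is a quadric of \<open>J\<close>, hence in \<open>I\<close>, and this rewriting is
  applied inside every monomial.\<close>

lemma reduce_mod_quadrics:
  assumes xy: "x \<noteq> y" and f: "f \<in> graded_piece (udeg x + udeg y + w)"
  shows "\<exists>f'\<in>graded_piece (udeg y + w). f - f' * l x \<in> I"
proof -
  have "\<exists>f'\<in>graded_piece (udeg y + w). single t 1 - f' * l x \<in> I" if t: "mon_deg t = udeg x + udeg y + w" for t
  proof -
    have "coord x (mon_deg t) > 0" using t by (simp add: coord_udeg)
    then obtain i s where s: "t = single (avar x i) 1 + s" using mon_factor by blast
    then have ds: "mon_deg s = udeg y + w"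
      using t unfolding s mon_deg_add mon_deg_avar by (simp add: add.assoc)
    then have "coord y (mon_deg s) > 0" by (simp add: coord_udeg)
    then obtain j s' where s': "s = single (avar y j) 1 + s'" using mon_factor by blast
    then have ds': "mon_deg s' = w"
      using ds unfolding s' mon_deg_add mon_deg_avar by simp
    let ?q = "var (avar y j) * var (avar x i)"
    have q: "?q \<in> graded_piece (udeg y + udeg x)"
      by (intro mult_in_graded_piece var_graded)
    have "udeg y + udeg x \<noteq> 0" "udeg y \<noteq> 0" by (cases x; cases y; simp add: zero_prod_def)+
    then have "hilbert_fun J (udeg y + udeg x) \<le> hilbert_fun J (udeg y)" by (simp add: h hfun_def)
    then obtain p where p: "p \<in> graded_piece (udeg y)" "?q - p * l x \<in> J"
      using hilbert_fun_nzd_surj[OF subspace_of_ideal[OF homogeneous_is_ideal[OF J]] l(2,1) _ q] by blast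
    have "?q - p * l x \<in> graded_piece (udeg y + udeg x)"
      by (rule poly.subspace_diff[OF subspace_graded_piece q mult_in_graded_piece[OF p(1) l(1)]])
    then have "?q - p * l x \<in> I" using JI[of y x] xy p(2) by blast
    then have "single s' 1 * (?q - p * l x) \<in> I" by (rule ideal_mult_left[OF I(1)])
    moreover have "single t 1 = single s' 1 * ?q"
      unfolding var_mult_var mult_single s s' by (simp add: ac_simps)
    ultimately have "single t 1 - (p * single s' 1) * l x \<in> I" by (simp add: algebra_simps)
    moreover have "p * single s' 1 \<in> graded_piece (udeg y + w)"
      using p(1) ds' by (intro mult_in_graded_piece single_in_graded_piece)
    ultimately show ?thesis by blast
  qed
  then obtain r where r: "\<And>t. mon_deg t = udeg x + udeg y + w \<Longrightarrow> r t \<in> graded_piece (udeg y + w)"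
    "\<And>t. mon_deg t = udeg x + udeg y + w \<Longrightarrow> single t 1 - r t * l x \<in> I" by metis
  have md: "mon_deg t = udeg x + udeg y + w" if "t \<in> keys f" for t
    using f that by (simp add: graded_piece_def)
  let ?f' = "\<Sum>t\<in>keys f. cscale (lookup f t) (r t)"
  have "?f' \<in> graded_piece (udeg y + w)"
    using r(1) md by (intro sum_cscale_graded) auto
  moreover have "f - ?f' * l x \<in> I"
  proof -
    have "f = (\<Sum>t\<in>keys f. cscale (lookup f t) (single t 1))"
      using pol_expand[of f] by (simp only: single_eq_cscale[symmetric])
    then have "f - ?f' * l x = (\<Sum>t\<in>keys f. cscale (lookup f t) (single t 1)) - ?f' * l x" by argo
    also have "\<dots> = (\<Sum>t\<in>keys f. cscale (lookup f t) (single t 1 - r t * l x))"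
      by (simp add: sum_distrib_right cscale_mult_left poly.scale_right_diff_distrib sum_subtractf)
    also have "\<dots> \<in> I"
      using r(2) md by (intro ideal.subspace_sum[OF I(1)] ideal_cscale[OF I(1)]) auto
    finally show ?thesis .
  qed
  ultimately show ?thesis by blast
qed

text \<open>Each new variable direction is removed by dividing by \<open>l x\<close> modulo
  \<open>I\<close>; the quotient stays in \<open>J\<close> because \<open>l x\<close> is a
  nonzerodivisor, and it has the degree of the induction hypothesis.\<close>

lemma graded_subset_of_quadrics:
  assumes ab: "a \<noteq> b"
  shows "J \<inter> graded_piece (udeg a + udeg b + w) \<subseteq> I"
proof (induction w rule: tridegree_induct)
  case zero
  then show ?case using JI[OF ab] by simp
next
  case (add w x)
  show ?case
  proof
    fix f assume f: "f \<in> J \<inter> graded_piece (udeg a + udeg b + (w + udeg x))"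
    \<comment> \<open>Since \<open>a\<close> and \<open>b\<close> differ, at least one of them is
      distinct from \<open>x\<close>.\<close>
    obtain y z where y: "x \<noteq> y" "udeg a + udeg b = udeg y + udeg z"
      using ab by (metis add.commute)
    have "udeg a + udeg b + (w + udeg x) = udeg x + udeg y + (udeg z + w)"
      unfolding y by (simp add: ac_simps)
    then obtain f' where f': "f' \<in> graded_piece (udeg y + (udeg z + w))" "f - f' * l x \<in> I"
      using reduce_mod_quadrics[OF y(1), of f "udeg z + w"] f by auto
    have "f - f' * l x \<in> J" using f'(2) I(2) by blast
    then have "f - (f - f' * l x) \<in> J"
      using f ideal.subspace_diff[OF homogeneous_is_ideal[OF J], of f "f - f' * l x"] by blast
    then have "f' \<in> J" using l(2)[of x] by (simp add: nzd_mod_def)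
    moreover have "f' \<in> graded_piece (udeg a + udeg b + w)"
      using f'(1) unfolding y by (simp add: ac_simps)
    ultimately have "f' * l x \<in> I" using add.IH ideal_mult_right[OF I(1)] by blast
    then have "(f - f' * l x) + f' * l x \<in> I" using f'(2) by (intro ideal.subspace_add[OF I(1)])
    then show "f \<in> I" by simp
  qed
qed

end

lemma three_axes: "u + (1, 1, 1) = udeg X1 + udeg X2 + (u + udeg X3)"
  by (cases u) simp

text \<open>In degrees with positive entries the inclusions through \<open>I\<close> and the equal
  Hilbert functions identify the ideals. Generators of the irrelevant ideal carry any element of
  \<open>J\<close> into such degrees, and saturation of \<open>J0\<close> brings it back; the
  Hilbert functions then settle the remaining degrees.\<close>

lemma hilbert_scheme_point_unique:
  fixes J J0 I :: "'n::finite cvar pol set"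
  assumes J: "homogeneous_ideal J" and J0: "homogeneous_ideal J0" "sat J0"
    and h: "hilbert_fun J = hilbert_fun J0" and I: "I \<subseteq> J"
    and sub: "\<And>u. J0 \<inter> graded_piece (u + (1, 1, 1)) \<subseteq> I"
  shows "J = J0"
proof (rule homogeneous_ideal_eqI[OF J J0(1)])
  fix u
  note iJ = homogeneous_is_ideal[OF J] and iJ0 = homogeneous_is_ideal[OF J0(1)]
  have eq: "J0 \<inter> graded_piece (u + (1, 1, 1)) = J \<inter> graded_piece (u + (1, 1, 1))"
    using sub[of u] I h by (intro hilbert_fun_eqD subspace_of_ideal iJ iJ0) auto
  have "J \<inter> graded_piece u \<subseteq> J0"
  proof
    fix f assume f: "f \<in> J \<inter> graded_piece u"
    have "f * (var (Alpha i) * var (Beta j) * var (Gamma k)) \<in> J0" for i j k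
      using ideal_mult_right[OF iJ] mult_in_graded_piece[OF _ var3_graded] f eq by blast
    then show "f \<in> J0" using J0(2) unfolding sat_def by blast
  qed
  then show "J \<inter> graded_piece u = J0 \<inter> graded_piece u"
    using h by (intro hilbert_fun_eqD subspace_of_ideal iJ iJ0) auto
qed

lemma is_ideal_sum3:
  assumes "is_ideal A" "is_ideal B" "is_ideal C"
  shows "is_ideal {a + b + c |a b c. a \<in> A \<and> b \<in> B \<and> c \<in> C}"
proof (rule is_idealI)
  show "0 \<in> {a + b + c |a b c. a \<in> A \<and> b \<in> B \<and> c \<in> C}"
    using assms[THEN ideal.subspace_0] by force
next
  fix x y assume "x \<in> {a + b + c |a b c. a \<in> A \<and> b \<in> B \<and> c \<in> C}" "y \<in> {a + b + c |a b c. a \<in> A \<and> b \<in> B \<and> c \<in> C}"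
  then obtain a b c a' b' c' where "x = a + b + c" "y = a' + b' + c'" "a \<in> A" "b \<in> B" "c \<in> C" "a' \<in> A" "b' \<in> B" "c' \<in> C"
    by blast
  then have "x + y = (a + a') + (b + b') + (c + c')" "a + a' \<in> A" "b + b' \<in> B" "c + c' \<in> C"
    using assms by (auto intro: ideal.subspace_add)
  then show "x + y \<in> {a + b + c |a b c. a \<in> A \<and> b \<in> B \<and> c \<in> C}" by blast
next
  fix r x assume "x \<in> {a + b + c |a b c. a \<in> A \<and> b \<in> B \<and> c \<in> C}"
  then obtain a b c where "x = a + b + c" "a \<in> A" "b \<in> B" "c \<in> C" by blast
  then have "r * x = r * a + r * b + r * c" "r * a \<in> A" "r * b \<in> B" "r * c \<in> C"
    using assms by (auto simp: algebra_simps intro: ideal_mult_left ideal_mult_right)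
  then show "r * x \<in> {a + b + c |a b c. a \<in> A \<and> b \<in> B \<and> c \<in> C}" by blast
qed

theorem corollary7p4:
  fixes F :: "'n::finite cvar pol"
  assumes "F \<in> graded_piece (1, 1, 1)"
    and "concise F"
    and "border_rank F = CARD('n)"
    and "\<not> wild F"
  defines "I \<equiv> {a + b + c |a b c.
      a \<in> ideal_gen (Ann F \<inter> graded_piece (1, 1, 0)) \<and>
      b \<in> ideal_gen (Ann F \<inter> graded_piece (1, 0, 1)) \<and>
      c \<in> ideal_gen (Ann F \<inter> graded_piece (0, 1, 1))}"
  shows "border_VSP F CARD('n) = {saturation I irrelevant_ideal}"
proof -
  let ?m = "CARD('n)"
  note F = assms(1) and conc = assms(2)
  define r where "r = smoothable_rank F"
  have r: "r \<le> ?m" using assms(3,4) by (simp add: wild_def r_def)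
  have "\<exists>J\<in>smoothable_subschemes r. J \<subseteq> Ann F"
    unfolding r_def smoothable_rank_def by (rule LeastI_ex[OF exists_smoothable[OF F]])
  then obtain J0 where J0: "J0 \<in> smoothable_subschemes r" "J0 \<subseteq> Ann F" by blast
  then obtain \<phi> where fin: "J0 \<in> finite_subschemes r" and \<phi>: "\<phi> \<in> frames (degs_ge r) (\<lambda>_. r) J0"
    unfolding smoothable_subschemes_def closure_in_def by blast
  have hom: "homogeneous_ideal J0" and B: "B_saturated J0"
    using fin by (auto simp: finite_subschemes_def)
  note ij = homogeneous_is_ideal[OF hom]
  have s: "sat J0" by (rule B_saturated_imp_sat[OF ij B])
  have hr: "hilbert_fun J0 u = r" if "u \<in> degs_ge r" for u
    by (rule hilbert_fun_frames[OF subspace_of_ideal[OF ij] \<phi> that])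
  have "freq_le J0 r"
    unfolding freq_le_def
  proof
    fix k0
    show "\<exists>k\<ge>k0. hilbert_fun J0 (k, k, k) \<le> r"
      by (rule exI[of _ "max k0 r"]) (simp add: hr)
  qed
  then have "\<exists>l\<in>graded_piece (udeg a). nzd_mod J0 l" for a
    by (rule exists_nzd_lin_form[OF hom s])
  then obtain l where l: "\<And>a. l a \<in> graded_piece (udeg a)" "\<And>a. nzd_mod J0 (l a)" by metis
  have J1: "J0 \<inter> graded_piece (udeg a) \<subseteq> {0}" for a
    using concise_axis[OF conc, of a] J0(2) by blast
  have rm: "r = ?m" and h: "hilbert_fun J0 = hfun ?m" and gen: "generic_hilbert_fun TYPE('n) ?m = hfun ?m"
    by (rule hilbert_fun_of_bound[OF hom l J1 hr r]; assumption)+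
  have Slip: "J0 \<in> Slip ?m"
    by (rule smoothable_in_Slip[OF l(1) hom l(2) J1 J0(1)[unfolded rm]])
  have iI: "is_ideal I" unfolding I_def by (intro is_ideal_sum3 ideal.subspace_span)
  have Ann_sub: "Ann F \<inter> graded_piece (udeg a + udeg b) \<subseteq> I" if "a \<noteq> b" for a b
  proof
    fix p assume p: "p \<in> Ann F \<inter> graded_piece (udeg a + udeg b)"
    note 0 = ideal.span_zero
    have "p = p + 0 + 0" "p = 0 + p + 0" "p = 0 + 0 + p" by simp_all
    moreover have "p \<in> ideal_gen (Ann F \<inter> graded_piece (1, 1, 0)) \<or>
      p \<in> ideal_gen (Ann F \<inter> graded_piece (1, 0, 1)) \<or> p \<in> ideal_gen (Ann F \<inter> graded_piece (0, 1, 1))"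
      using p that by (cases a; cases b) (auto intro: ideal.span_base)
    ultimately show "p \<in> I" unfolding I_def using 0 by blast
  qed
  \<comment> \<open>Stated for a general \<open>J\<close> because it is applied both to
    \<open>J0\<close> and to an arbitrary member of the border variety.\<close>
  have I_sub: "I \<subseteq> J" if J: "homogeneous_ideal J" "J \<subseteq> Ann F" "hilbert_fun J = hfun ?m" for J :: "'n cvar pol set"
  proof -
    note iJ = homogeneous_is_ideal[OF J(1)]
    have "J \<inter> graded_piece (udeg a + udeg b) = Ann F \<inter> graded_piece (udeg a + udeg b)" if "a \<noteq> b" for a b
      using that by (intro graded_Ann_eq[OF F conc] iJ J(2)) (cases a; cases b; simp add: J(3) hfun_def zero_prod_def)+
    from this[of X1 X2] this[of X1 X3] this[of X2 X3]
    have "ideal_gen (Ann F \<inter> graded_piece (1, 1, 0)) \<subseteq> J" "ideal_gen (Ann F \<inter> graded_piece (1, 0, 1)) \<subseteq> J"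
      "ideal_gen (Ann F \<inter> graded_piece (0, 1, 1)) \<subseteq> J"
      by (auto intro!: ideal.span_minimal[OF _ iJ])
    then show ?thesis unfolding I_def using ideal.subspace_add[OF iJ] by blast
  qed
  note I0 = I_sub[OF hom J0(2) h]
  have JI: "J0 \<inter> graded_piece (udeg a + udeg b) \<subseteq> I" if "a \<noteq> b" for a b
    using Ann_sub[OF that] J0(2) by blast
  have sub: "J0 \<inter> graded_piece (u + (1, 1, 1)) \<subseteq> I" for u
    unfolding three_axes by (rule graded_subset_of_quadrics[OF hom iI I0 l h JI]) simp_all
  have K: "saturation I irrelevant_ideal = J0"
  proof
    have "saturation I irrelevant_ideal \<subseteq> saturation J0 irrelevant_ideal"
      using I0 unfolding saturation_def by blast
    then show "saturation I irrelevant_ideal \<subseteq> J0" using B by (simp add: B_saturated_def)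
  next
    show "J0 \<subseteq> saturation I irrelevant_ideal"
    proof
      fix f assume f: "f \<in> J0"
      show "f \<in> saturation I irrelevant_ideal"
      proof (rule saturationI[OF iI])
        fix i j k :: 'n
        let ?v = "var (Alpha i) * var (Beta j) * var (Gamma k)"
        \<comment> \<open>A generator of the irrelevant ideal raises all three degrees by one, into
          the range of \<open>sub\<close>; components are treated separately because
          \<open>sub\<close> concerns graded pieces.\<close>
        have "hom_component u f * ?v \<in> I" for u
          using sub[of u] mult_in_graded_piece[OF hom_component_in var3_graded] ideal_mult_right[OF ij]
            homogeneous_ideal_iff[OF hom, of f] f by blast
        then have "(\<Sum>u\<in>mon_deg ` keys f. hom_component u f * ?v) \<in> I"
          by (intro ideal.subspace_sum[OF iI])
        then show "f * ?v \<in> I" using sum_hom_components[of f] by (simp flip: sum_distrib_right)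
      qed
    qed
  qed
  have "J = J0" if "J \<in> border_VSP F ?m" for J
  proof -
    have "J \<in> Slip ?m" and sF: "J \<subseteq> Ann F" using that by (auto simp: border_VSP_def)
    then have "J \<in> multigraded_hilb (hfun ?m)"
      unfolding Slip_def Let_def gen closure_in_def by blast
    then have hJ: "homogeneous_ideal J" "hilbert_fun J = hfun ?m"
      by (auto simp: multigraded_hilb_def)
    show ?thesis
      by (rule hilbert_scheme_point_unique[OF hJ(1) hom s _ I_sub[OF hJ(1) sF hJ(2)] sub]) (simp add: hJ(2) h)
  qed
  moreover have "J0 \<in> border_VSP F ?m" using Slip J0(2) by (simp add: border_VSP_def)
  ultimately show ?thesis unfolding K by blast
qed

end
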